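(* Let $\mathcal{A}\in\mathbb{R}^{n_1\times n_2\times n_3\times\cdots\times n_m}$ have nonzero horizontal slices $\mathcal{A}(1),\dots,\mathcal{A}(n_1)$, and let $\mathcal{B}\in\mathbb{R}^{n_1\times l\times n_3\times\cdots\times n_m}$ be such that $\mathcal{A}*_L\mathcal{X}=\mathcal{B}$ has a solution $\mathcal X\in\mathbb{R}^{n_2\times l\times n_3\times\cdots\times n_m}$. Let $\lambda,\varepsilon,t>0$ and for $\mathcal{X}\in\mathbb{R}^{n_2\times l\times n_3\times\cdots\times n_m}$ let $$f(\mathcal{X})=\sum_{i_1,\dots,i_m}\lambda\log\left(1+\frac{|\mathcal{X}_{i_1,\dots,i_m}|}{\varepsilon}\right)+\frac12\|\mathcal{X}\|_F^2 ,$$ the sum being over all entries of $\mathcal{X}$. Let $(\mathcal{Z}^{(k)},\mathcal{X}^{(k)})_{k\ge 0}$ be generated by the LSP regularized Kaczmarz iteration (described in the context) with the index $i(k)\in\{1,\dots,n_1\}$ chosen cyclically. If $$t<\left(2-\frac{2\lambda}{\varepsilon^2}\right)/\rho,$$ then for every $k\ge 0$ and every $\mathcal{X}$ with $\mathcal{A}*_L\mathcal{X}=\mathcal{B}$, $$D_{f,\mathcal{Z}^{(k+1)}}(\mathcal{X}^{(k+1)},\mathcal{X})\le D_{f,\mathcal{Z}^{(k)}}(\mathcal{X}^{(k)},\mathcal{X})-t\left(1-\frac{t\rho}{2-\frac{2\lambda}{\varepsilon^2}}\right)\frac{\|\mathcal{A}(i(k))*_L(\mathcal{X}^{(k)}-\mathcal{X})\|_F^2}{\|\mathcal{A}(i(k))\|_F^2}.$$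 Moreover, the sequence $\{\mathcal{X}^{(k)}\}$ converges to the solution of $\operatorname{argmin}_{\mathcal{X}} f(\mathcal{X})$ subject to $\mathcal{A}*_L\mathcal{X}=\mathcal{B}$.
   Context: Let $m\ge 3$. For invertible matrices $U_{n_i}\in\mathbb{C}^{n_i\times n_i}$, $i=3,\dots,m$, the linear transform $L$ acts on $m$-th order tensors whose last $m-2$ dimensions are $n_3,\dots,n_m$ (first two dimensions arbitrary) by $L(\mathcal{A})=\mathcal{A}\times_3U_{n_3}\times_4\cdots\times_mU_{n_m}=:\mathcal{A}_L$, where $\times_i$ is the mode-$i$ product (the mode-$i$ unfolding of $\mathcal{A}\times_iU$ is $U$ times the mode-$i$ unfolding of $\mathcal{A}$). It is assumed that there is a constant $\rho>0$ such that, with $K=U_{n_m}\otimes U_{n_{m-1}}\otimes\cdots\otimes U_{n_3}$, one has $KK^*=K^*K=\rho I$. The facewise product $\mathcal{A}\Delta\mathcal{B}$ multiplies corresponding frontal slices: $(\mathcal{A}\Delta\mathcal{B})(:,:,i_3,\dots,i_m)=\mathcal{A}(:,:,i_3,\dots,i_m)\,\mathcal{B}(:,:,i_3,\dots,i_m)$. The $L$-based t-product is $\mathcal{A}*_L\mathcal{B}=L^{-1}(\mathcal{A}_L\Delta\mathcal{B}_L)$; $L$ is such that $*_L$ maps pairs of real tensors to real tensors. The conjugate transpose $\mathcal{A}^*$ is defined by $(\mathcal{A}^* )_L(:,:,i_3,\dots,i_m)=(\mathcal{A}_L(:,:,i_3,\dots,i_m))^*$. $\langle\cdot,\cdot\rangle$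 and $\|\cdot\|_F$ are the entrywise inner product and Frobenius norm. $\mathcal{A}(i)$ denotes the $i$-th horizontal slice $\mathcal{A}(i,:,\dots,:)$, of size $1\times n_2\times n_3\times\cdots\times n_m$ (similarly for $\mathcal{B}(i)$). The row space is $R(\mathcal{A})=\{\mathcal{A}^**_L\mathcal{Y}:\mathcal{Y}\in\mathbb{R}^{n_1\times l\times n_3\times\cdots\times n_m}\}$. $\partial f(\mathcal{X})=\{\mathcal{X}^*: f(\mathcal{Y})\ge f(\mathcal{X})+\langle\mathcal{X}^*,\mathcal{Y}-\mathcal{X}\rangle\ \forall\mathcal{Y}\}$ (here $\mathcal X^*$ denotes a subgradient). For convex $f$ and $\mathcal{Z}\in\partial f(\mathcal{X})$ the Bregman distance is $D_{f,\mathcal{Z}}(\mathcal{X},\mathcal{Y})=f(\mathcal{Y})-f(\mathcal{X})-\langle\mathcal{Z},\mathcal{Y}-\mathcal{X}\rangle$. Standing assumption: the optimal solution $\hat{\mathcal{X}}$ of $\min f(\mathcal{X})$ s.t. $\mathcal{A}*_L\mathcal{X}=\mathcal{B}$ satisfies $\partial f(\hat{\mathcal{X}})\cap R(\mathcal{A})\neq\emptyset$. With $\mathrm{LSP}(\mathcal{X})=\sum_{i_1,\dots,i_m}\log(1+|\mathcal{X}_{i_1,\dots,i_m}|/\varepsilon)$, define $\mathrm{prox}_{\lambda\mathrm{LSP}}(\mathcal{Z})=\operatorname{argmin}_{\mathcal{X}}\lambda\,\mathrm{LSP}(\mathcal{X})+\frac12\|\mathcal{X}-\mathcal{Z}\|_F^2$.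 LSP regularized Kaczmarz iteration: choose $\mathcal{Z}^{(0)}\in R(\mathcal{A})$, $\mathcal{X}^{(0)}=\mathrm{prox}_{\lambda\mathrm{LSP}}(\mathcal{Z}^{(0)})$; for $k=0,1,2,\dots$ choose an index $i(k)\in\{1,\dots,n_1\}$ and set $$\mathcal{Z}^{(k+1)}=\mathcal{Z}^{(k)}+t\,(\mathcal{A}(i(k)))^**_L\frac{\mathcal{B}(i(k))-\mathcal{A}(i(k))*_L\mathcal{X}^{(k)}}{\|\mathcal{A}(i(k))\|_F^2},\qquad \mathcal{X}^{(k+1)}=\mathrm{prox}_{\lambda\mathrm{LSP}}(\mathcal{Z}^{(k+1)}).$$ The iteration is run indefinitely (no stopping tolerance). The algorithm's parameters $\lambda,\varepsilon$ are chosen so that $(|z|+\varepsilon)^2\ge4\lambda$ for every entry $z$ of every tensor $\mathcal{Z}^{(k)}$ to which the prox is applied. Cyclic choice means $i(k)=(k\bmod n_1)+1$. *)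

theory Defs
  imports
    Complex_Main
    "HOL-Library.Function_Algebras"
    "Jordan_Normal_Form.Schur_Decomposition"
begin

text \<open>
  A tensor of size \<open>d\<^sub>1 \<times> \<dots> \<times> d\<^sub>m\<close> is a complex function on multi-indices
  \<open>[i\<^sub>1, \<dots>, i\<^sub>m]\<close> that vanishes outside the index box of \<open>[d\<^sub>1, \<dots>, d\<^sub>m]\<close>, so that equality of
  tensors is equality of functions. Indices count from \<open>0\<close>, modes count from \<open>1\<close>.
  Real tensors are those with entries in \<open>\<real>\<close>.
\<close>

type_synonym tensor = "nat list \<Rightarrow> complex"

definition index_box :: "nat list \<Rightarrow> nat list set" where
  "index_box ds = {ix. list_all2 (<) ix ds}"

definition tensors :: "nat list \<Rightarrow> tensor set" where
  "tensors ds = {A. \<forall>ix. ix \<notin> index_box ds \<longrightarrow> A ix = 0}"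

definition real_tensors :: "nat list \<Rightarrow> tensor set" where
  "real_tensors ds = {A \<in> tensors ds. \<forall>ix. A ix \<in> \<real>}"

text \<open>On real tensors this is \<open>\<Sum> A\<^sub>i B\<^sub>i\<close>; the real part only makes it real-valued.\<close>

definition tinner :: "nat list \<Rightarrow> tensor \<Rightarrow> tensor \<Rightarrow> real" where
  "tinner ds A B = (\<Sum>ix\<in>index_box ds. Re (A ix * cnj (B ix)))"

definition tnorm :: "nat list \<Rightarrow> tensor \<Rightarrow> real" where
  "tnorm ds A = sqrt (\<Sum>ix\<in>index_box ds. (cmod (A ix))\<^sup>2)"

definition tscale :: "real \<Rightarrow> tensor \<Rightarrow> tensor" where
  "tscale c A = (\<lambda>ix. complex_of_real c * A ix)"

text \<open>
  The mode-\<open>i\<close> product written entrywise: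
  \<open>(A \<times>\<^sub>i U)(\<dots>, j, \<dots>) = \<Sum>\<^sub>k U\<^sub>j\<^sub>k A(\<dots>, k, \<dots>)\<close>, the free index standing at position \<open>i\<close>
  (list position \<open>i - 1\<close>).
\<close>

definition mode_prod :: "nat \<Rightarrow> complex mat \<Rightarrow> tensor \<Rightarrow> tensor" where
  "mode_prod i U A = (\<lambda>ix.
     if ix ! (i - 1) < dim_row U
     then (\<Sum>k<dim_col U. U $$ (ix ! (i - 1), k) * A (ix[i - 1 := k]))
     else 0)"

definition kronecker :: "complex mat \<Rightarrow> complex mat \<Rightarrow> complex mat" where
  "kronecker A B = mat (dim_row A * dim_row B) (dim_col A * dim_col B)
     (\<lambda>(i, j). A $$ (i div dim_row B, j div dim_col B) * B $$ (i mod dim_row B, j mod dim_col B))"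

text \<open>The sizes \<open>n\<^sub>3, \<dots>, n\<^sub>m\<close> of the last \<open>m - 2\<close> modes.\<close>

definition tail_dims :: "nat \<Rightarrow> (nat \<Rightarrow> nat) \<Rightarrow> nat list" where
  "tail_dims m n = map n [3..<Suc m]"

text \<open>\<open>L(A) = A \<times>\<^sub>3 U\<^sub>3 \<times>\<^sub>4 \<dots> \<times>\<^sub>m U\<^sub>m\<close>\<close>

definition transform :: "nat \<Rightarrow> (nat \<Rightarrow> complex mat) \<Rightarrow> tensor \<Rightarrow> tensor" where
  "transform m U A = fold (\<lambda>i. mode_prod i (U i)) [3..<Suc m] A"

text \<open>\<open>K = U\<^sub>m \<otimes> U\<^sub>m\<^sub>-\<^sub>1 \<otimes> \<dots> \<otimes> U\<^sub>3\<close>\<close>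

definition transform_kron :: "nat \<Rightarrow> (nat \<Rightarrow> complex mat) \<Rightarrow> complex mat" where
  "transform_kron m U = fold (\<lambda>i K. kronecker (U i) K) [4..<Suc m] (U 3)"

text \<open>\<open>L\<^sup>-\<^sup>1\<close> on tensors of size \<open>p \<times> q \<times> n\<^sub>3 \<times> \<dots> \<times> n\<^sub>m\<close>.\<close>

definition inv_transform ::
  "nat \<Rightarrow> (nat \<Rightarrow> nat) \<Rightarrow> (nat \<Rightarrow> complex mat) \<Rightarrow> nat \<Rightarrow> nat \<Rightarrow> tensor \<Rightarrow> tensor" where
  "inv_transform m n U p q = inv_into (tensors (p # q # tail_dims m n)) (transform m U)"

text \<open>Slicewise matrix product, where \<open>q\<close> is the common inner dimension.\<close>

definition facewise_prod :: "nat \<Rightarrow> tensor \<Rightarrow> tensor \<Rightarrow> tensor" where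
  "facewise_prod q A B = (\<lambda>ix. case ix of
     i # j # is \<Rightarrow> (\<Sum>k<q. A (i # k # is) * B (k # j # is))
   | _ \<Rightarrow> 0)"

definition facewise_adjoint :: "tensor \<Rightarrow> tensor" where
  "facewise_adjoint A = (\<lambda>ix. case ix of
     i # j # is \<Rightarrow> cnj (A (j # i # is))
   | _ \<Rightarrow> 0)"

text \<open>
  \<open>A *\<^sub>L B\<close> for \<open>A\<close> of size \<open>p \<times> q \<times> n\<^sub>3 \<times> \<dots> \<times> n\<^sub>m\<close> and \<open>B\<close> of size
  \<open>q \<times> r \<times> n\<^sub>3 \<times> \<dots> \<times> n\<^sub>m\<close>.
\<close>

definition tprod ::
  "nat \<Rightarrow> (nat \<Rightarrow> nat) \<Rightarrow> (nat \<Rightarrow> complex mat) \<Rightarrow> nat \<Rightarrow> nat \<Rightarrow> nat \<Rightarrow> tensor \<Rightarrow> tensor \<Rightarrow> tensor"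
  where
  "tprod m n U p q r A B =
     inv_transform m n U p r (facewise_prod q (transform m U A) (transform m U B))"

text \<open>Conjugate transpose of a tensor of size \<open>p \<times> q \<times> n\<^sub>3 \<times> \<dots> \<times> n\<^sub>m\<close>.\<close>

definition tadjoint ::
  "nat \<Rightarrow> (nat \<Rightarrow> nat) \<Rightarrow> (nat \<Rightarrow> complex mat) \<Rightarrow> nat \<Rightarrow> nat \<Rightarrow> tensor \<Rightarrow> tensor" where
  "tadjoint m n U p q A = inv_transform m n U q p (facewise_adjoint (transform m U A))"

text \<open>The horizontal slice \<open>A(i, :, \<dots>, :)\<close>, kept as a tensor whose first mode has size \<open>1\<close>.\<close>

definition hslice :: "tensor \<Rightarrow> nat \<Rightarrow> tensor" where
  "hslice A i = (\<lambda>ix. case ix of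
     j # is \<Rightarrow> (if j = 0 then A (i # is) else 0)
   | [] \<Rightarrow> 0)"

definition row_space ::
  "nat \<Rightarrow> (nat \<Rightarrow> nat) \<Rightarrow> (nat \<Rightarrow> complex mat) \<Rightarrow> nat \<Rightarrow> tensor \<Rightarrow> tensor set" where
  "row_space m n U l A =
     {tprod m n U (n 2) (n 1) l (tadjoint m n U (n 1) (n 2) A) Y | Y.
        Y \<in> real_tensors (n 1 # l # tail_dims m n)}"

definition subdifferential :: "nat list \<Rightarrow> (tensor \<Rightarrow> real) \<Rightarrow> tensor \<Rightarrow> tensor set" where
  "subdifferential ds f X =
     {S \<in> real_tensors ds. \<forall>Y\<in>real_tensors ds. f Y \<ge> f X + tinner ds S (Y - X)}"

definition bregman :: "nat list \<Rightarrow> (tensor \<Rightarrow> real) \<Rightarrow> tensor \<Rightarrow> tensor \<Rightarrow> tensor \<Rightarrow> real" where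
  "bregman ds f Z X Y = f Y - f X - tinner ds Z (Y - X)"

definition LSP :: "nat list \<Rightarrow> real \<Rightarrow> tensor \<Rightarrow> real" where
  "LSP ds \<epsilon> X = (\<Sum>ix\<in>index_box ds. ln (1 + cmod (X ix) / \<epsilon>))"

text \<open>The proximal operator as the set of all real minimisers.\<close>

definition prox_LSP :: "nat list \<Rightarrow> real \<Rightarrow> real \<Rightarrow> tensor \<Rightarrow> tensor set" where
  "prox_LSP ds lam \<epsilon> Z =
     {X. is_arg_min (\<lambda>X. lam * LSP ds \<epsilon> X + 1/2 * (tnorm ds (X - Z))\<^sup>2)
           (\<lambda>X. X \<in> real_tensors ds) X}"

definition lsp_objective :: "nat list \<Rightarrow> real \<Rightarrow> real \<Rightarrow> tensor \<Rightarrow> real" where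
  "lsp_objective ds lam \<epsilon> X =
     (\<Sum>ix\<in>index_box ds. lam * ln (1 + cmod (X ix) / \<epsilon>)) + 1/2 * (tnorm ds X)\<^sup>2"

text \<open>The real solutions, of size \<open>n\<^sub>2 \<times> l \<times> n\<^sub>3 \<times> \<dots> \<times> n\<^sub>m\<close>, of \<open>A *\<^sub>L X = B\<close>.\<close>

definition solutions ::
  "nat \<Rightarrow> (nat \<Rightarrow> nat) \<Rightarrow> (nat \<Rightarrow> complex mat) \<Rightarrow> nat \<Rightarrow> tensor \<Rightarrow> tensor \<Rightarrow> tensor set" where
  "solutions m n U l A B =
     {X \<in> real_tensors (n 2 # l # tail_dims m n). tprod m n U (n 1) (n 2) l A X = B}"

text \<open>
  \<open>(Z\<^sup>(\<^sup>k\<^sup>), X\<^sup>(\<^sup>k\<^sup>))\<close> is a run of the LSP regularized Kaczmarz iteration with step size \<open>t\<close> that uses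
  the horizontal slice with index \<open>i k\<close> in step \<open>k\<close>.
\<close>

definition lsp_kaczmarz ::
  "nat \<Rightarrow> (nat \<Rightarrow> nat) \<Rightarrow> (nat \<Rightarrow> complex mat) \<Rightarrow> nat \<Rightarrow> tensor \<Rightarrow> tensor \<Rightarrow>
   real \<Rightarrow> real \<Rightarrow> real \<Rightarrow> (nat \<Rightarrow> nat) \<Rightarrow> (nat \<Rightarrow> tensor) \<Rightarrow> (nat \<Rightarrow> tensor) \<Rightarrow> bool" where
  "lsp_kaczmarz m n U l A B lam \<epsilon> t i Z X \<longleftrightarrow>
     Z 0 \<in> row_space m n U l A \<and>
     (\<forall>k. X k \<in> prox_LSP (n 2 # l # tail_dims m n) lam \<epsilon> (Z k)) \<and>
     (\<forall>k. Z (Suc k) = Z k + tscale t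
        (tprod m n U (n 2) 1 l (tadjoint m n U 1 (n 2) (hslice A (i k)))
          (tscale (1 / (tnorm (1 # n 2 # tail_dims m n) (hslice A (i k)))\<^sup>2)
            (hslice B (i k) - tprod m n U 1 (n 2) l (hslice A (i k)) (X k)))))"

end

theory Submission
  imports Defs "HOL-Analysis.Convex" "HOL-Analysis.Topology_Euclidean_Space"
begin

text \<open>
  The iteration is a mirror descent for the strongly convex function \<open>f\<close>. Although the penalty
  \<open>lam ln (1 + |x|/\<epsilon>)\<close> is concave in \<open>|x|\<close>, its curvature is at least \<open>- lam/\<epsilon>\<^sup>2\<close>, so adding
  \<open>x\<^sup>2/2\<close> makes \<open>f\<close> strongly convex with modulus \<open>\<sigma> = 1 - lam/\<epsilon>\<^sup>2\<close>, which the bound on \<open>t\<close> forces to be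
  positive (\<open>lsp_objective_strongly_convex\<close>). The proximal point \<open>X\<close> of \<open>Z\<close> is the minimiser of
  \<open>f - \<langle>Z, \<cdot>\<rangle>\<close>, in other words \<open>Z\<close> is a subgradient of \<open>f\<close> at \<open>X\<close>, even with the additional term
  \<open>\<sigma>/2 \<parallel>Y - X\<parallel>\<^sup>2\<close> (\<open>prox_LSP_strong_subgradient\<close>).

  The tensor structure enters through two facts about a horizontal slice \<open>a\<close>: the conjugate
  transpose is the adjoint for the inner product, \<open>\<langle>a\<^sup>* *\<^sub>L W, X\<rangle> = \<langle>W, a *\<^sub>L X\<rangle>\<close>
  (\<open>cinner_tprod_tadjoint\<close>), and \<open>\<parallel>a\<^sup>* *\<^sub>L W\<parallel>\<^sup>2 \<le> \<rho> \<parallel>a\<parallel>\<^sup>2 \<parallel>W\<parallel>\<^sup>2\<close> (\<open>tnorm_tprod_tadjoint_row\<close>). Both are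
  immediate for slicewise matrix products and are carried back by the transform \<open>L\<close>, which is
  \<open>\<surd>\<rho>\<close> times a unitary map (\<open>cinner_transform\<close>). The assumption on the Kronecker product of the
  matrices gives this property of \<open>L\<close> because it forces each single matrix to be a multiple of a
  unitary one (\<open>transform_kron_factors_scaled_isometry\<close>).

  For a solution \<open>Y\<close> let \<open>r\<close> be the residual \<open>a *\<^sub>L (X\<^sub>k - Y)\<close> of the slice used in step \<open>k\<close>. By the two
  facts, the dual increment \<open>Z\<^sub>k\<^sub>+\<^sub>1 - Z\<^sub>k\<close> pairs with \<open>X\<^sub>k - Y\<close> to \<open>- t \<parallel>r\<parallel>\<^sup>2/\<parallel>a\<parallel>\<^sup>2\<close> and has squared norm
  at most \<open>t\<^sup>2 \<rho> \<parallel>r\<parallel>\<^sup>2/\<parallel>a\<parallel>\<^sup>2\<close>. The strong subgradient inequality then yields the claimed decrease of the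
  Bregman distance (\<open>bregman_mirror_step\<close>).

  The decrease makes the iterates bounded and the residuals vanish; limit points are solutions
  since the slices are visited cyclically, the Bregman distance to a limit point tends to zero, and
  the limit is optimal because the dual iterates remain orthogonal to the kernel of \<open>A\<close>
  (\<open>kaczmarz_dual_orthogonal\<close>, \<open>cyclic_bregman_convergence\<close>). Compactness provides the limit point,
  so that the existence of a minimiser is part of the conclusion.
\<close>

section \<open>Tensors as a finite-dimensional inner product space\<close>

lemma index_box_Cons: "index_box (d # ds) = (\<lambda>(i, is). i # is) ` ({..<d} \<times> index_box ds)"
  by (auto simp: index_box_def list_all2_Cons2 image_iff)

lemma finite_index_box: "finite (index_box ds)"
proof (induction ds)
  case Nil
  then show ?case by (simp add: index_box_def)
next
  case (Cons d ds)
  then show ?case by (simp add: index_box_Cons)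
qed

lemma sum_index_box_Cons:
  "(\<Sum>ix\<in>index_box (d # ds). g ix) = (\<Sum>i<d. \<Sum>is\<in>index_box ds. g (i # is))"
proof -
  have "inj_on (\<lambda>(i, is). i # is) ({..<d} \<times> index_box ds)"
    by (auto simp: inj_on_def)
  then show ?thesis
    by (simp add: index_box_Cons sum.reindex sum.cartesian_product case_prod_unfold)
qed

lemma index_box_iff_nth:
  "ix \<in> index_box ds \<longleftrightarrow> length ix = length ds \<and> (\<forall>j<length ds. ix ! j < ds ! j)"
  by (auto simp: index_box_def list_all2_conv_all_nth)

lemma index_box_update:
  assumes "ix \<in> index_box ds" "k < ds ! j"
  shows "ix[j := k] \<in> index_box ds"
proof -
  have "ix[j := k] ! j' < ds ! j'" if "j' < length ds" for j'
    using assms that by (cases "j' = j") (auto simp: index_box_iff_nth)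
  then show ?thesis
    using assms by (simp add: index_box_iff_nth)
qed

lemma tensors_vanish: "A \<in> tensors ds \<Longrightarrow> ix \<notin> index_box ds \<Longrightarrow> A ix = 0"
  by (simp add: tensors_def)

lemma tensors_eqI:
  assumes "A \<in> tensors ds" "B \<in> tensors ds" "\<And>ix. ix \<in> index_box ds \<Longrightarrow> A ix = B ix"
  shows "A = B"
proof
  show "A ix = B ix" for ix
    using assms by (cases "ix \<in> index_box ds") (auto simp: tensors_vanish)
qed

lemma tensors_diff: "A \<in> tensors ds \<Longrightarrow> B \<in> tensors ds \<Longrightarrow> A - B \<in> tensors ds"
  by (simp add: tensors_def)

lemma tensors_add: "A \<in> tensors ds \<Longrightarrow> B \<in> tensors ds \<Longrightarrow> A + B \<in> tensors ds"
  by (simp add: tensors_def)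

lemma tensors_scale: "A \<in> tensors ds \<Longrightarrow> tscale c A \<in> tensors ds"
  by (simp add: tensors_def tscale_def)

lemma real_tensors_tensors: "A \<in> real_tensors ds \<Longrightarrow> A \<in> tensors ds"
  by (simp add: real_tensors_def)

lemma real_tensors_diff: "A \<in> real_tensors ds \<Longrightarrow> B \<in> real_tensors ds \<Longrightarrow> A - B \<in> real_tensors ds"
  by (simp add: real_tensors_def tensors_diff)

lemma real_tensors_add: "A \<in> real_tensors ds \<Longrightarrow> B \<in> real_tensors ds \<Longrightarrow> A + B \<in> real_tensors ds"
  by (simp add: real_tensors_def tensors_add)

lemma real_tensors_scale: "A \<in> real_tensors ds \<Longrightarrow> tscale c A \<in> real_tensors ds"
  by (simp add: real_tensors_def tensors_scale) (simp add: tscale_def)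

text \<open>The Hermitian product behind \<open>tinner\<close>. The transform has complex matrices, so adjointness and
  isometry are statements about this product; \<open>tinner\<close> is its real part.\<close>

definition cinner :: "nat list \<Rightarrow> tensor \<Rightarrow> tensor \<Rightarrow> complex" where
  "cinner ds A B = (\<Sum>ix\<in>index_box ds. A ix * cnj (B ix))"

lemma tinner_cinner: "tinner ds A B = Re (cinner ds A B)"
  by (simp add: tinner_def cinner_def Re_sum)

lemma tnorm_sq_sum: "(tnorm ds A)\<^sup>2 = (\<Sum>ix\<in>index_box ds. (cmod (A ix))\<^sup>2)"
  by (simp add: tnorm_def sum_nonneg)

lemma tnorm_sq: "(tnorm ds A)\<^sup>2 = tinner ds A A"
  by (simp add: tnorm_sq_sum tinner_def complex_mult_cnj cmod_power2 sum.distrib)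

lemma tnorm_L2_set: "tnorm ds A = L2_set (\<lambda>ix. cmod (A ix)) (index_box ds)"
  by (simp add: tnorm_def L2_set_def)

lemma tnorm_nonneg: "0 \<le> tnorm ds A"
  by (simp add: tnorm_L2_set)

lemma tnorm_eq_0_iff: "A \<in> tensors ds \<Longrightarrow> tnorm ds A = 0 \<longleftrightarrow> A = 0"
  by (auto simp: tnorm_L2_set L2_set_eq_0_iff finite_index_box tensors_def fun_eq_iff)

lemma cmod_le_tnorm: "ix \<in> index_box ds \<Longrightarrow> cmod (A ix) \<le> tnorm ds A"
  unfolding tnorm_L2_set by (rule member_le_L2_set) (auto simp: finite_index_box)

lemma tnorm_triangle: "tnorm ds (A + B) \<le> tnorm ds A + tnorm ds B"
  unfolding tnorm_L2_set
  by (rule order_trans[OF L2_set_mono L2_set_triangle_ineq]) (auto simp: norm_triangle_ineq)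

lemma tnorm_minus_commute: "tnorm ds (A - B) = tnorm ds (B - A)"
  by (simp add: tnorm_def norm_minus_commute)

lemma tinner_le_tnorm: "tinner ds A B \<le> tnorm ds A * tnorm ds B"
proof -
  have "tinner ds A B \<le> (\<Sum>ix\<in>index_box ds. \<bar>cmod (A ix)\<bar> * \<bar>cmod (B ix)\<bar>)"
    unfolding tinner_def
  proof (rule sum_mono)
    fix ix
    have "Re (A ix * cnj (B ix)) \<le> cmod (A ix * cnj (B ix))"
      by (rule complex_Re_le_cmod)
    then show "Re (A ix * cnj (B ix)) \<le> \<bar>cmod (A ix)\<bar> * \<bar>cmod (B ix)\<bar>"
      by (simp add: norm_mult)
  qed
  also have "\<dots> \<le> tnorm ds A * tnorm ds B"
    unfolding tnorm_L2_set by (rule L2_set_mult_ineq)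
  finally show ?thesis .
qed

lemma tinner_add_left: "tinner ds (A + B) C = tinner ds A C + tinner ds B C"
  and tinner_diff_left: "tinner ds (A - B) C = tinner ds A C - tinner ds B C"
  and tinner_add_right: "tinner ds C (A + B) = tinner ds C A + tinner ds C B"
  and tinner_diff_right: "tinner ds C (A - B) = tinner ds C A - tinner ds C B"
  and tinner_scale_left: "tinner ds (tscale c A) C = c * tinner ds A C"
  and tinner_scale_right: "tinner ds C (tscale c A) = c * tinner ds C A"
  by (simp_all add: tinner_def tscale_def algebra_simps sum.distrib sum_subtractf sum_distrib_left)

lemma tinner_commute: "tinner ds A B = tinner ds B A"
  by (simp add: tinner_def algebra_simps)

lemma tnorm_scale: "tnorm ds (tscale c A) = \<bar>c\<bar> * tnorm ds A"
proof (rule power2_eq_imp_eq)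
  show "(tnorm ds (tscale c A))\<^sup>2 = (\<bar>c\<bar> * tnorm ds A)\<^sup>2"
    by (simp add: power_mult_distrib tnorm_sq tinner_scale_left tinner_scale_right)
      (simp add: power2_eq_square)
qed (simp_all add: tnorm_nonneg)

lemmas tinner_linear = tinner_add_left tinner_diff_left tinner_add_right tinner_diff_right
  tinner_scale_left tinner_scale_right

section \<open>Mode products\<close>

lemma mode_prod_tensors:
  assumes "U \<in> carrier_mat (ds ! (i - 1)) (ds ! (i - 1))" "A \<in> tensors ds"
  shows "mode_prod i U A \<in> tensors ds"
proof -
  have "mode_prod i U A ix = 0" if out: "ix \<notin> index_box ds" for ix
  proof (cases "ix ! (i - 1) < ds ! (i - 1)")
    case True
    have "ix[i - 1 := k] \<notin> index_box ds" for k
      using out index_box_update[of "ix[i - 1 := k]" ds "ix ! (i - 1)" "i - 1"] True by auto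
    then show ?thesis
      using assms(2) by (simp add: mode_prod_def tensors_vanish)
  qed (use assms(1) in \<open>simp add: mode_prod_def\<close>)
  then show ?thesis
    by (simp add: tensors_def)
qed

lemma mode_prod_diff: "mode_prod i U (A - B) = mode_prod i U A - mode_prod i U B"
  by (auto simp: mode_prod_def fun_eq_iff algebra_simps sum_subtractf)

text \<open>Mode products in the same mode compose like matrices, so invertible matrices make the transform
  surjective.\<close>

lemma mode_prod_right_inverse:
  assumes U: "U \<in> carrier_mat (ds ! (i - 1)) (ds ! (i - 1))"
    and V: "V \<in> carrier_mat (ds ! (i - 1)) (ds ! (i - 1))"
    and UV: "U * V = 1\<^sub>m (ds ! (i - 1))"
    and i: "i - 1 < length ds" and A: "A \<in> tensors ds"
  shows "mode_prod i U (mode_prod i V A) = A"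
proof (rule tensors_eqI)
  show "mode_prod i U (mode_prod i V A) \<in> tensors ds"
    using U V A by (intro mode_prod_tensors)
  show "A \<in> tensors ds" by fact
  fix ix assume ix: "ix \<in> index_box ds"
  let ?j = "i - 1" and ?d = "ds ! (i - 1)"
  have len: "?j < length ix" and lt: "ix ! ?j < ?d"
    using ix i by (auto simp: index_box_iff_nth)
  have entry: "(\<Sum>k<?d. U $$ (ix ! ?j, k) * V $$ (k, a)) = (if a = ix ! ?j then 1 else 0)"
    if "a < ?d" for a
  proof -
    have "(U * V) $$ (ix ! ?j, a) = (\<Sum>k<?d. U $$ (ix ! ?j, k) * V $$ (k, a))"
      using U V lt that by (simp add: scalar_prod_def lessThan_atLeast0)
    then show ?thesis
      using UV lt that by auto
  qed
  have "mode_prod i U (mode_prod i V A) ix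
      = (\<Sum>k<?d. U $$ (ix ! ?j, k) * (\<Sum>a<?d. V $$ (k, a) * A (ix[?j := a])))"
    using U V lt len by (simp add: mode_prod_def)
  also have "\<dots> = (\<Sum>a<?d. (\<Sum>k<?d. U $$ (ix ! ?j, k) * V $$ (k, a)) * A (ix[?j := a]))"
    by (simp add: sum_distrib_left sum_distrib_right mult.assoc) (rule sum.swap)
  also have "\<dots> = (\<Sum>a<?d. (if a = ix ! ?j then A (ix[?j := a]) else 0))"
    by (rule sum.cong) (simp_all only: lessThan_iff entry, simp_all)
  also have "\<dots> = A ix"
    using lt by simp
  finally show "mode_prod i U (mode_prod i V A) ix = A ix" .
qed

text \<open>Exchanging the \<open>j\<close>-th coordinate of a multi-index with a summation variable of the same range
  is an involution of the summation domain.\<close>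

lemma sum_index_box_exchange:
  assumes "j < length ds"
  shows "(\<Sum>ix\<in>index_box ds. \<Sum>k<ds ! j. g ix k)
       = (\<Sum>ix\<in>index_box ds. \<Sum>k<ds ! j. g (ix[j := k]) (ix ! j))"
proof -
  let ?S = "index_box ds \<times> {..<ds ! j}"
  let ?w = "\<lambda>(ix, k). (ix[j := k], ix ! j)"
  have "?w p \<in> ?S \<and> ?w (?w p) = p" if "p \<in> ?S" for p
    using that assms by (auto simp: index_box_iff_nth nth_list_update)
  then have "(\<Sum>p\<in>?S. case p of (ix, k) \<Rightarrow> g ix k) = (\<Sum>p\<in>?S. case ?w p of (ix, k) \<Rightarrow> g ix k)"
    by (intro sum.reindex_bij_witness[of _ ?w ?w]) (auto simp del: split_paired_All)
  then show ?thesis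
    by (simp add: sum.cartesian_product case_prod_unfold)
qed

text \<open>\<open>U\<^sup>*U = u I\<close>, written entrywise for a matrix with \<open>d\<close> rows and \<open>d\<close> columns.\<close>

definition scaled_isometry :: "nat \<Rightarrow> complex mat \<Rightarrow> complex \<Rightarrow> bool" where
  "scaled_isometry d U u \<longleftrightarrow>
     (\<forall>a<d. \<forall>b<d. (\<Sum>k<d. cnj (U $$ (k, a)) * U $$ (k, b)) = (if a = b then u else 0))"

text \<open>Expanding both products gives a sum over a multi-index and two further indices. Exchanging the
  \<open>i\<close>-th coordinate with one of them makes the inner sum an entry of \<open>U\<^sup>*U\<close>.\<close>

lemma cinner_mode_prod:
  assumes U: "U \<in> carrier_mat (ds ! (i - 1)) (ds ! (i - 1))"
    and iso: "scaled_isometry (ds ! (i - 1)) U u"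
    and i: "i - 1 < length ds"
  shows "cinner ds (mode_prod i U A) (mode_prod i U B) = u * cinner ds A B"
proof -
  let ?j = "i - 1" and ?d = "ds ! (i - 1)"
  let ?b = "\<lambda>a ix. \<Sum>l<?d. cnj (U $$ (a, l)) * cnj (B (ix[?j := l]))"
  have lt: "ix ! ?j < ?d" "?j < length ix" if "ix \<in> index_box ds" for ix
    using that i by (auto simp: index_box_iff_nth)
  have "cinner ds (mode_prod i U A) (mode_prod i U B)
      = (\<Sum>ix\<in>index_box ds. \<Sum>k<?d. U $$ (ix ! ?j, k) * A (ix[?j := k]) * ?b (ix ! ?j) ix)"
    unfolding cinner_def
    by (rule sum.cong) (use U lt in \<open>auto simp: mode_prod_def sum_distrib_right\<close>)
  also have "\<dots> = (\<Sum>ix\<in>index_box ds. \<Sum>k<?d. U $$ (k, ix ! ?j) * A ix * ?b k ix)"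
    by (subst sum_index_box_exchange[OF i]) (use lt in \<open>auto intro!: sum.cong\<close>)
  also have "\<dots> = (\<Sum>ix\<in>index_box ds. A ix * (u * cnj (B ix)))"
  proof (rule sum.cong)
    fix ix assume ix: "ix \<in> index_box ds"
    have "(\<Sum>k<?d. U $$ (k, ix ! ?j) * A ix * ?b k ix)
        = A ix * (\<Sum>l<?d. (\<Sum>k<?d. cnj (U $$ (k, l)) * U $$ (k, ix ! ?j)) * cnj (B (ix[?j := l])))"
      by (simp add: sum_distrib_left sum_distrib_right mult_ac) (rule sum.swap)
    also have "(\<Sum>l<?d. (\<Sum>k<?d. cnj (U $$ (k, l)) * U $$ (k, ix ! ?j)) * cnj (B (ix[?j := l])))
        = (\<Sum>l<?d. if l = ix ! ?j then u * cnj (B (ix[?j := l])) else 0)"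
      by (rule sum.cong) (use iso lt[OF ix] in \<open>auto simp: scaled_isometry_def\<close>)
    also have "\<dots> = u * cnj (B ix)"
      using lt[OF ix] by simp
    finally show "(\<Sum>k<?d. U $$ (k, ix ! ?j) * A ix * ?b k ix) = A ix * (u * cnj (B ix))" .
  qed simp
  also have "\<dots> = u * cinner ds A B"
    by (simp add: cinner_def sum_distrib_left algebra_simps)
  finally show ?thesis .
qed

section \<open>The transform is a multiple of a unitary map\<close>

lemma sum_lessThan_times:
  "(\<Sum>k<a * b. g k) = (\<Sum>k1<a. \<Sum>k2<b. g (k1 * b + k2))" for a b :: nat
proof (induction a)
  case (Suc a)
  have "(\<Sum>k<Suc a * b. g k) = (\<Sum>k<a * b. g k) + (\<Sum>k=a * b..<a * b + b. g k)"
    by (simp add: lessThan_atLeast0 sum.atLeastLessThan_concat add.commute)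
  also have "(\<Sum>k=a * b..<a * b + b. g k) = (\<Sum>k2<b. g (a * b + k2))"
    using sum.shift_bounds_nat_ivl[of g 0 "a * b" b] by (simp add: lessThan_atLeast0 add.commute)
  finally show ?case
    using Suc by simp
qed simp

lemma kronecker_carrier:
  "U \<in> carrier_mat a a \<Longrightarrow> V \<in> carrier_mat b b \<Longrightarrow> kronecker U V \<in> carrier_mat (a * b) (a * b)"
  by (simp add: kronecker_def)

text \<open>The Gram matrix of \<open>U \<otimes> V\<close> is the Kronecker product of the Gram matrices of \<open>U\<close> and \<open>V\<close>. If it is
  a nonzero multiple of the identity, comparing each of its blocks with the block at the origin
  forces both factors to be multiples of the identity.\<close>

lemma scaled_isometry_kronecker:
  assumes U: "U \<in> carrier_mat a a" and V: "V \<in> carrier_mat b b" and a: "0 < a" and b: "0 < b"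
    and iso: "scaled_isometry (a * b) (kronecker U V) w" and w: "w \<noteq> 0"
  obtains u v where "scaled_isometry a U u" "scaled_isometry b V v" "u * v = w"
proof -
  let ?GU = "\<lambda>i j. \<Sum>k<a. cnj (U $$ (k, i)) * U $$ (k, j)"
  let ?GV = "\<lambda>i j. \<Sum>k<b. cnj (V $$ (k, i)) * V $$ (k, j)"
  have less: "i * b + k < a * b" if "i < a" "k < b" for i k
  proof -
    have "i * b + k < Suc i * b" using that by simp
    also have "\<dots> \<le> a * b" using that by (intro mult_right_mono) auto
    finally show ?thesis .
  qed
  have entry: "kronecker U V $$ (i1 * b + i2, j1 * b + j2) = U $$ (i1, j1) * V $$ (i2, j2)"
    if "i1 < a" "i2 < b" "j1 < a" "j2 < b" for i1 i2 j1 j2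
    using that less[of i1 i2] less[of j1 j2] U V by (simp add: kronecker_def)
  have gram: "?GU i1 j1 * ?GV i2 j2 = (if i1 = j1 \<and> i2 = j2 then w else 0)"
    if lt: "i1 < a" "j1 < a" "i2 < b" "j2 < b" for i1 j1 i2 j2
  proof -
    have eq_iff: "i1 * b + i2 = j1 * b + j2 \<longleftrightarrow> i1 = j1 \<and> i2 = j2"
    proof
      assume *: "i1 * b + i2 = j1 * b + j2"
      have "(i1 * b + i2) div b = (j1 * b + j2) div b" "(i1 * b + i2) mod b = (j1 * b + j2) mod b"
        by (simp_all only: *)
      then show "i1 = j1 \<and> i2 = j2"
        using lt by simp
    qed simp
    have "?GU i1 j1 * ?GV i2 j2
        = (\<Sum>k1<a. \<Sum>k2<b. cnj (kronecker U V $$ (k1 * b + k2, i1 * b + i2))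
             * kronecker U V $$ (k1 * b + k2, j1 * b + j2))"
      unfolding sum_product
    proof (intro sum.cong refl)
      fix k1 k2 assume "k1 \<in> {..<a}" "k2 \<in> {..<b}"
      then have "kronecker U V $$ (k1 * b + k2, i1 * b + i2) = U $$ (k1, i1) * V $$ (k2, i2)"
        "kronecker U V $$ (k1 * b + k2, j1 * b + j2) = U $$ (k1, j1) * V $$ (k2, j2)"
        using lt by (auto intro: entry)
      then show "cnj (U $$ (k1, i1)) * U $$ (k1, j1) * (cnj (V $$ (k2, i2)) * V $$ (k2, j2))
          = cnj (kronecker U V $$ (k1 * b + k2, i1 * b + i2))
             * kronecker U V $$ (k1 * b + k2, j1 * b + j2)"
        by simp
    qed
    also have "\<dots> = (\<Sum>k<a * b. cnj (kronecker U V $$ (k, i1 * b + i2))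
             * kronecker U V $$ (k, j1 * b + j2))"
      by (rule sum_lessThan_times[symmetric])
    also have "\<dots> = (if i1 = j1 \<and> i2 = j2 then w else 0)"
      using iso less lt unfolding scaled_isometry_def by (simp add: eq_iff)
    finally show ?thesis .
  qed
  \<comment> \<open>The corner entries are the two scalars; both are nonzero as their product is \<open>w\<close>.\<close>
  have uv: "?GU 0 0 * ?GV 0 0 = w"
    using gram[of 0 0 0 0] a b by simp
  with w have u0: "?GU 0 0 \<noteq> 0" and v0: "?GV 0 0 \<noteq> 0"
    by auto
  have "scaled_isometry a U (?GU 0 0)"
    unfolding scaled_isometry_def
  proof (intro allI impI)
    fix i j assume "i < a" "j < a"
    then have "?GU i j * ?GV 0 0 = (if i = j then ?GU 0 0 else 0) * ?GV 0 0"
      using gram[of i j 0 0] b uv by simp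
    then show "?GU i j = (if i = j then ?GU 0 0 else 0)"
      by (rule mult_right_cancel[OF v0, THEN iffD1])
  qed
  moreover have "scaled_isometry b V (?GV 0 0)"
    unfolding scaled_isometry_def
  proof (intro allI impI)
    fix i j assume "i < b" "j < b"
    then have "?GU 0 0 * ?GV i j = ?GU 0 0 * (if i = j then ?GV 0 0 else 0)"
      using gram[of 0 0 i j] a uv by simp
    then show "?GV i j = (if i = j then ?GV 0 0 else 0)"
      by (rule mult_left_cancel[OF u0, THEN iffD1])
  qed
  ultimately show ?thesis
    using uv that by blast
qed

lemma transform_kron_3: "transform_kron 3 U = U 3"
  by (simp add: transform_kron_def)

lemma transform_kron_Suc:
  "3 \<le> M \<Longrightarrow> transform_kron (Suc M) U = kronecker (U (Suc M)) (transform_kron M U)"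
  by (simp add: transform_kron_def)

lemma prod_atLeast3_Suc: "3 \<le> M \<Longrightarrow> (\<Prod>i=3..Suc M. g i) = g (Suc M) * (\<Prod>i=3..M. g i)"
  for g :: "nat \<Rightarrow> 'a::comm_monoid_mult"
  by (simp add: mult.commute)

lemma transform_kron_carrier:
  assumes "3 \<le> M" "\<And>i. i \<in> {3..M} \<Longrightarrow> U i \<in> carrier_mat (n i) (n i)"
  shows "transform_kron M U \<in> carrier_mat (\<Prod>i=3..M. n i) (\<Prod>i=3..M. n i)"
  using assms
proof (induction M rule: dec_induct)
  case base
  then show ?case by (simp add: transform_kron_3)
next
  case (step M)
  then show ?case
    by (simp add: transform_kron_Suc prod_atLeast3_Suc kronecker_carrier del: prod.cl_ivl_Suc)
qed

text \<open>If a Kronecker product is a nonzero multiple of a unitary matrix, so is each factor. This lets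
  the transform be treated one mode at a time, so that no vectorisation of tensors has to be
  matched with the ordering of the Kronecker product.\<close>

lemma transform_kron_factors_scaled_isometry:
  assumes "3 \<le> M" "\<And>i. i \<in> {3..M} \<Longrightarrow> U i \<in> carrier_mat (n i) (n i) \<and> 0 < n i"
    and "scaled_isometry (\<Prod>i=3..M. n i) (transform_kron M U) w" "w \<noteq> 0"
  shows "\<exists>u. (\<forall>i\<in>{3..M}. scaled_isometry (n i) (U i) (u i)) \<and> (\<Prod>i=3..M. u i) = w"
  using assms
proof (induction M arbitrary: w rule: dec_induct)
  case base
  then show ?case
    by (intro exI[of _ "\<lambda>_. w"]) (simp add: transform_kron_3)
next
  case (step M)
  let ?N = "\<Prod>i=3..M. n i"
  have K: "transform_kron M U \<in> carrier_mat ?N ?N"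
    using step by (intro transform_kron_carrier) auto
  have N: "0 < ?N"
    using step by (intro prod_pos) auto
  have "U (Suc M) \<in> carrier_mat (n (Suc M)) (n (Suc M))" "0 < n (Suc M)"
    using step by auto
  moreover have "scaled_isometry (n (Suc M) * ?N) (kronecker (U (Suc M)) (transform_kron M U)) w"
    using step(5) step(1) by (simp only: transform_kron_Suc prod_atLeast3_Suc)
  ultimately obtain v v' where v: "scaled_isometry (n (Suc M)) (U (Suc M)) v"
    and v': "scaled_isometry ?N (transform_kron M U) v'" and vv': "v * v' = w"
    by (rule scaled_isometry_kronecker[OF _ K _ N _ \<open>w \<noteq> 0\<close>])
  have "\<exists>u. (\<forall>i\<in>{3..M}. scaled_isometry (n i) (U i) (u i)) \<and> (\<Prod>i=3..M. u i) = v'"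
  proof (rule step.IH[OF _ v'])
    show "U i \<in> carrier_mat (n i) (n i) \<and> 0 < n i" if "i \<in> {3..M}" for i
      using step.prems(1)[of i] that by simp
    show "v' \<noteq> 0"
      using vv' \<open>w \<noteq> 0\<close> by auto
  qed
  then obtain u where u: "\<forall>i\<in>{3..M}. scaled_isometry (n i) (U i) (u i)" "(\<Prod>i=3..M. u i) = v'"
    by blast
  let ?u = "u(Suc M := v)"
  have "(\<Prod>i=3..M. ?u i) = (\<Prod>i=3..M. u i)"
    by (intro prod.cong) auto
  then have "(\<Prod>i=3..Suc M. ?u i) = w"
    using u(2) vv' step(1) by (simp only: prod_atLeast3_Suc) simp
  moreover have "\<forall>i\<in>{3..Suc M}. scaled_isometry (n i) (U i) (?u i)"
    using u(1) v by (auto simp: le_Suc_eq)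
  ultimately show ?case
    by blast
qed

lemma scaled_isometryI:
  assumes U: "U \<in> carrier_mat d d" and UU: "mat_adjoint U * U = w \<cdot>\<^sub>m 1\<^sub>m d"
  shows "scaled_isometry d U w"
  unfolding scaled_isometry_def
proof (intro allI impI)
  fix a b assume ab: "a < d" "b < d"
  have "(mat_adjoint U * U) $$ (a, b) = (\<Sum>k<d. cnj (U $$ (k, a)) * U $$ (k, b))"
    using U ab by (simp add: mat_adjoint_def scalar_prod_def lessThan_atLeast0)
  then show "(\<Sum>k<d. cnj (U $$ (k, a)) * U $$ (k, b)) = (if a = b then w else 0)"
    unfolding UU using ab by (simp split: if_splits)
qed

lemma fold_mode_prod_tensors:
  assumes "\<forall>i\<in>set is. U i \<in> carrier_mat (ds ! (i - 1)) (ds ! (i - 1))" "A \<in> tensors ds"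
  shows "fold (\<lambda>i. mode_prod i (U i)) is A \<in> tensors ds"
  using assms by (induction "is" arbitrary: A) (simp_all add: mode_prod_tensors del: One_nat_def)

lemma fold_mode_prod_diff:
  "fold (\<lambda>i. mode_prod i (U i)) is (A - B)
     = fold (\<lambda>i. mode_prod i (U i)) is A - fold (\<lambda>i. mode_prod i (U i)) is B"
  by (induction "is" arbitrary: A B) (auto simp: mode_prod_diff)

lemma cinner_fold_mode_prod:
  assumes "\<forall>i\<in>set is. i - 1 < length ds \<and> U i \<in> carrier_mat (ds ! (i - 1)) (ds ! (i - 1))
             \<and> scaled_isometry (ds ! (i - 1)) (U i) (u i)"
  shows "cinner ds (fold (\<lambda>i. mode_prod i (U i)) is A) (fold (\<lambda>i. mode_prod i (U i)) is B)
       = prod_list (map u is) * cinner ds A B"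
  using assms by (induction "is" arbitrary: A B) (simp_all add: cinner_mode_prod prod_list.Cons mult_ac del: One_nat_def)

lemma invertible_mat_right_inverse:
  assumes "U \<in> carrier_mat d d" "invertible_mat U"
  obtains V where "V \<in> carrier_mat d d" "U * V = 1\<^sub>m d"
proof -
  obtain V where V: "U * V = 1\<^sub>m d" "V * U = 1\<^sub>m (dim_row V)"
    using assms by (auto simp: invertible_mat_def inverts_mat_def)
  have "dim_col V = d" using V(1) by (metis index_mult_mat(3) index_one_mat(3))
  moreover have "dim_row V = d"
    using V(2) assms(1) by (metis carrier_matD(2) index_mult_mat(3) index_one_mat(3))
  ultimately show ?thesis
    using that V(1) by blast
qed

lemma fold_mode_prod_surj:
  assumes "\<forall>i\<in>set is. i - 1 < length ds \<and> U i \<in> carrier_mat (ds ! (i - 1)) (ds ! (i - 1))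
             \<and> invertible_mat (U i)"
    and "F \<in> tensors ds"
  shows "\<exists>A\<in>tensors ds. fold (\<lambda>i. mode_prod i (U i)) is A = F"
  using assms(1)
proof (induction "is")
  case Nil
  then show ?case using assms(2) by auto
next
  case (Cons i "is")
  then obtain A where A: "A \<in> tensors ds" "fold (\<lambda>i. mode_prod i (U i)) is A = F"
    by auto
  have i: "i - 1 < length ds" "U i \<in> carrier_mat (ds ! (i - 1)) (ds ! (i - 1))" "invertible_mat (U i)"
    using Cons.prems by simp_all
  obtain V where V: "V \<in> carrier_mat (ds ! (i - 1)) (ds ! (i - 1))" "U i * V = 1\<^sub>m (ds ! (i - 1))"
    using invertible_mat_right_inverse[OF i(2,3)] .
  have "mode_prod i (U i) (mode_prod i V A) = A"
    by (rule mode_prod_right_inverse[OF i(2) V i(1) A(1)])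
  then have "fold (\<lambda>i. mode_prod i (U i)) (i # is) (mode_prod i V A) = F"
    using A(2) by simp
  then show ?case
    using mode_prod_tensors[OF V(1) A(1)] by blast
qed

lemma hslice_mode_prod:
  assumes "3 \<le> i"
  shows "mode_prod i U (hslice A j) = hslice (mode_prod i U A) j"
proof
  fix ix show "mode_prod i U (hslice A j) ix = hslice (mode_prod i U A) j ix"
  proof (cases ix)
    case (Cons h "is")
    define i' where "i' = i - 2"
    have i': "i - 1 = Suc i'"
      using assms by (simp add: i'_def)
    show ?thesis
      unfolding mode_prod_def hslice_def i' Cons by simp
  qed (simp add: mode_prod_def hslice_def)
qed

lemma transform_hslice: "transform m U (hslice A j) = hslice (transform m U A) j"
proof -
  have "fold (\<lambda>i. mode_prod i (U i)) is (hslice A j) = hslice (fold (\<lambda>i. mode_prod i (U i)) is A) j"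
    if "\<forall>i\<in>set is. 3 \<le> i" for "is"
    using that by (induction "is" arbitrary: A) (auto simp: hslice_mode_prod)
  then show ?thesis
    by (simp add: transform_def del: upt_Suc)
qed

lemma hslice_tensors:
  assumes "A \<in> tensors (p # ds)"
  shows "hslice A j \<in> tensors (1 # ds)"
proof -
  have "hslice A j ix = 0" if "ix \<notin> index_box (1 # ds)" for ix
    using that assms by (cases ix) (auto simp: hslice_def index_box_def tensors_def)
  then show ?thesis by (simp add: tensors_def)
qed

text \<open>An equation of tensors splits into the equations of its horizontal slices; the Kaczmarz
  iteration treats one of them per step.\<close>

lemma hslice_eq_imp_eq:
  assumes "A \<in> tensors (p # ds)" "B \<in> tensors (p # ds)" "\<And>j. j < p \<Longrightarrow> hslice A j = hslice B j"
  shows "A = B"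
proof (rule tensors_eqI[OF assms(1,2)])
  fix ix assume "ix \<in> index_box (p # ds)"
  then obtain j "is" where ix: "ix = j # is" "j < p"
    by (auto simp: index_box_Cons)
  then have "hslice A j (0 # is) = hslice B j (0 # is)"
    using assms(3) by simp
  then show "A ix = B ix"
    using ix by (simp add: hslice_def)
qed

lemma sum_exchange_outer_inner:
  "(\<Sum>i\<in>I. \<Sum>j\<in>J. \<Sum>s\<in>S. \<Sum>k\<in>K. g i j s k) = (\<Sum>k\<in>K. \<Sum>j\<in>J. \<Sum>s\<in>S. \<Sum>i\<in>I. g i j s k)"
  unfolding sum.cartesian_product
  by (rule sum.reindex_bij_witness[of _ "\<lambda>(k, j, s, i). (i, j, s, k)" "\<lambda>(i, j, s, k). (k, j, s, i)"]) auto

section \<open>The t-product\<close>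

text \<open>Under these assumptions \<open>L\<close> is \<open>\<surd>\<rho>\<close> times a unitary map on the tensors of every size
  \<open>p \<times> q \<times> n\<^sub>3 \<times> \<dots> \<times> n\<^sub>m\<close>.\<close>

locale scaled_unitary_transform =
  fixes m :: nat and n :: "nat \<Rightarrow> nat" and U :: "nat \<Rightarrow> complex mat" and \<rho> :: real
  assumes modes: "3 \<le> m"
    and sizes: "i \<in> {3..m} \<Longrightarrow> 0 < n i"
    and matrices: "i \<in> {3..m} \<Longrightarrow> U i \<in> carrier_mat (n i) (n i) \<and> invertible_mat (U i)"
    and scale_pos: "0 < \<rho>"
    and gram: "mat_adjoint (transform_kron m U) * transform_kron m U
                 = complex_of_real \<rho> \<cdot>\<^sub>m 1\<^sub>m (\<Prod>i=3..m. n i)"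
begin

abbreviation dims :: "nat \<Rightarrow> nat \<Rightarrow> nat list" where
  "dims p q \<equiv> p # q # tail_dims m n"

abbreviation L :: "tensor \<Rightarrow> tensor" where
  "L \<equiv> transform m U"

lemma dims_nth: "i \<in> {3..m} \<Longrightarrow> i - 1 < length (dims p q) \<and> dims p q ! (i - 1) = n i"
proof -
  assume i: "i \<in> {3..m}"
  define j where "j = i - 3"
  have "i = Suc (Suc (Suc j))" "j < Suc m - 3"
    using i by (auto simp: j_def)
  then show ?thesis
    by (simp add: tail_dims_def numeral_3_eq_3 del: upt_Suc)
qed

lemma modes_dims:
  "\<forall>i\<in>set [3..<Suc m]. i - 1 < length (dims p q)
     \<and> U i \<in> carrier_mat (dims p q ! (i - 1)) (dims p q ! (i - 1)) \<and> invertible_mat (U i)"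
proof
  fix i assume "i \<in> set [3..<Suc m]"
  then have i: "i \<in> {3..m}"
    by auto
  show "i - 1 < length (dims p q)
     \<and> U i \<in> carrier_mat (dims p q ! (i - 1)) (dims p q ! (i - 1)) \<and> invertible_mat (U i)"
    using matrices[OF i] dims_nth[OF i, of p q] by metis
qed

lemma transform_tensors: "A \<in> tensors (dims p q) \<Longrightarrow> L A \<in> tensors (dims p q)"
  unfolding transform_def
  by (rule fold_mode_prod_tensors) (use modes_dims in blast)

lemma transform_surj:
  assumes "F \<in> tensors (dims p q)"
  shows "\<exists>A\<in>tensors (dims p q). L A = F"
  unfolding transform_def
  by (rule fold_mode_prod_surj[OF modes_dims assms])

lemma transform_diff: "L (A - B) = L A - L B"
  unfolding transform_def by (rule fold_mode_prod_diff)

lemma cinner_transform: "cinner (dims p q) (L A) (L B) = complex_of_real \<rho> * cinner (dims p q) A B"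
proof -
  have "scaled_isometry (\<Prod>i=3..m. n i) (transform_kron m U) (complex_of_real \<rho>)"
    using modes matrices by (intro scaled_isometryI transform_kron_carrier gram) auto
  then obtain u where u: "\<forall>i\<in>{3..m}. scaled_isometry (n i) (U i) (u i)"
    and prod: "(\<Prod>i=3..m. u i) = complex_of_real \<rho>"
    using transform_kron_factors_scaled_isometry[of m U n "complex_of_real \<rho>"]
      modes matrices sizes scale_pos by auto
  have "cinner (dims p q) (L A) (L B) = prod_list (map u [3..<Suc m]) * cinner (dims p q) A B"
    unfolding transform_def
  proof (rule cinner_fold_mode_prod, rule ballI)
    fix i assume i: "i \<in> set [3..<Suc m]"
    then have "i \<in> {3..m}"
      by auto
    with i show "i - 1 < length (dims p q) \<and> U i \<in> carrier_mat (dims p q ! (i - 1)) (dims p q ! (i - 1))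
        \<and> scaled_isometry (dims p q ! (i - 1)) (U i) (u i)"
      using u modes_dims[of p q] dims_nth[of i p q] by metis
  qed
  also have "prod_list (map u [3..<Suc m]) = (\<Prod>i=3..m. u i)"
    by (subst prod.distinct_set_conv_list[symmetric]) (simp_all del: upt_Suc add: atLeastLessThanSuc_atLeastAtMost)
  finally show ?thesis
    by (simp add: prod)
qed

lemma tnorm_transform: "(tnorm (dims p q) (L A))\<^sup>2 = \<rho> * (tnorm (dims p q) A)\<^sup>2"
  by (simp add: tnorm_sq tinner_cinner cinner_transform)

lemma transform_inj:
  assumes "A \<in> tensors (dims p q)" "B \<in> tensors (dims p q)" "L A = L B"
  shows "A = B"
proof -
  have "L (A - B) = 0"
    using assms(3) by (simp add: transform_diff)
  then have "\<rho> * (tnorm (dims p q) (A - B))\<^sup>2 = 0"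
    by (simp flip: tnorm_transform) (simp add: tnorm_def)
  then have "tnorm (dims p q) (A - B) = 0"
    using scale_pos by simp
  then show ?thesis
    using tnorm_eq_0_iff[OF tensors_diff[OF assms(1,2)]] by simp
qed

lemma inv_transform:
  assumes "F \<in> tensors (dims p q)"
  shows "inv_transform m n U p q F \<in> tensors (dims p q)" "L (inv_transform m n U p q F) = F"
proof -
  have F: "F \<in> L ` tensors (dims p q)"
    using transform_surj[OF assms] by auto
  show "inv_transform m n U p q F \<in> tensors (dims p q)"
    unfolding inv_transform_def by (rule inv_into_into[OF F])
  show "L (inv_transform m n U p q F) = F"
    unfolding inv_transform_def by (rule f_inv_into_f[OF F])
qed

lemma facewise_prod_tensors:
  assumes "A \<in> tensors (p # q # ts)" "B \<in> tensors (q # r # ts)"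
  shows "facewise_prod q A B \<in> tensors (p # r # ts)"
proof -
  have "facewise_prod q A B ix = 0" if "ix \<notin> index_box (p # r # ts)" for ix
  proof -
    consider "\<nexists>i j is. ix = i # j # is" | i j "is" where "ix = i # j # is"
      by blast
    then show ?thesis
    proof cases
      case 1
      then show ?thesis
        by (auto simp: facewise_prod_def split: list.split)
    next
      case 2
      then have "A (i # k # is) * B (k # j # is) = 0" for k
        using that assms by (auto simp: tensors_def index_box_def)
      then show ?thesis
        using 2 by (simp add: facewise_prod_def)
    qed
  qed
  then show ?thesis
    by (simp add: tensors_def)
qed

lemma facewise_adjoint_tensors:
  assumes "A \<in> tensors (p # q # ts)"
  shows "facewise_adjoint A \<in> tensors (q # p # ts)"
proof -
  have "facewise_adjoint A ix = 0" if "ix \<notin> index_box (q # p # ts)" for ix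
    using that assms
    by (auto simp: facewise_adjoint_def tensors_def index_box_def split: list.split)
  then show ?thesis
    by (simp add: tensors_def)
qed

text \<open>A product is determined by its transform, and there it is the slicewise matrix product; this is
  the form in which all identities below are checked.\<close>

lemma tprod:
  assumes "A \<in> tensors (dims p q)" "B \<in> tensors (dims q r)"
  shows "tprod m n U p q r A B \<in> tensors (dims p r)"
    and "L (tprod m n U p q r A B) = facewise_prod q (L A) (L B)"
  using inv_transform[OF facewise_prod_tensors[OF transform_tensors[OF assms(1)] transform_tensors[OF assms(2)]]]
  by (simp_all add: tprod_def)

lemma tadjoint:
  assumes "A \<in> tensors (dims p q)"
  shows "tadjoint m n U p q A \<in> tensors (dims q p)"
    and "L (tadjoint m n U p q A) = facewise_adjoint (L A)"
  using inv_transform[OF facewise_adjoint_tensors[OF transform_tensors[OF assms(1)]]]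
  by (simp_all add: tadjoint_def)

lemma tprod_diff_right:
  assumes "A \<in> tensors (dims p q)" "B \<in> tensors (dims q r)" "C \<in> tensors (dims q r)"
  shows "tprod m n U p q r A (B - C) = tprod m n U p q r A B - tprod m n U p q r A C"
proof (rule transform_inj)
  show "L (tprod m n U p q r A (B - C)) = L (tprod m n U p q r A B - tprod m n U p q r A C)"
    using assms by (simp add: tprod tensors_diff transform_diff)
      (auto simp: facewise_prod_def fun_eq_iff algebra_simps sum_subtractf split: list.split)
qed (use assms in \<open>auto intro!: tprod tensors_diff\<close>)

lemma hslice_tprod:
  assumes "A \<in> tensors (dims p q)" "B \<in> tensors (dims q r)"
  shows "tprod m n U 1 q r (hslice A j) B = hslice (tprod m n U p q r A B) j"
proof (rule transform_inj)
  show "L (tprod m n U 1 q r (hslice A j) B) = L (hslice (tprod m n U p q r A B) j)"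
    unfolding tprod(2)[OF hslice_tensors[OF assms(1)] assms(2)] transform_hslice tprod(2)[OF assms]
    by (auto simp: facewise_prod_def hslice_def fun_eq_iff split: list.split)
  show "tprod m n U 1 q r (hslice A j) B \<in> tensors (dims 1 r)"
    by (rule tprod(1)[OF hslice_tensors[OF assms(1)] assms(2)])
  show "hslice (tprod m n U p q r A B) j \<in> tensors (dims 1 r)"
    by (rule hslice_tensors[OF tprod(1)[OF assms]])
qed

text \<open>The conjugate transpose is the Hilbert space adjoint: for the slices in the transform domain
  this is the adjointness of matrices, and the factors \<open>\<rho>\<close> on both sides cancel.\<close>

lemma cinner_tprod_tadjoint:
  assumes A: "A \<in> tensors (dims p q)" and W: "W \<in> tensors (dims p r)" and X: "X \<in> tensors (dims q r)"
  shows "cinner (dims q r) (tprod m n U q p r (tadjoint m n U p q A) W) X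
       = cinner (dims p r) W (tprod m n U p q r A X)"
proof -
  let ?ts = "tail_dims m n"
  let ?F = "facewise_prod p (facewise_adjoint (L A)) (L W)" and ?G = "facewise_prod q (L A) (L X)"
  have "complex_of_real \<rho> * cinner (dims q r) (tprod m n U q p r (tadjoint m n U p q A) W) X
      = cinner (dims q r) ?F (L X)"
    unfolding cinner_transform[symmetric] tprod(2)[OF tadjoint(1)[OF A] W] tadjoint(2)[OF A] ..
  also have "\<dots> = (\<Sum>i<q. \<Sum>j<r. \<Sum>is\<in>index_box ?ts. \<Sum>k<p.
           cnj (L A (k # i # is)) * L W (k # j # is) * cnj (L X (i # j # is)))"
    by (simp add: cinner_def sum_index_box_Cons facewise_prod_def facewise_adjoint_def sum_distrib_right)
  also have "\<dots> = (\<Sum>k<p. \<Sum>j<r. \<Sum>is\<in>index_box ?ts. \<Sum>i<q.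
           cnj (L A (k # i # is)) * L W (k # j # is) * cnj (L X (i # j # is)))"
    by (rule sum_exchange_outer_inner)
  also have "\<dots> = cinner (dims p r) (L W) ?G"
    by (simp add: cinner_def sum_index_box_Cons facewise_prod_def sum_distrib_left mult_ac)
  also have "\<dots> = complex_of_real \<rho> * cinner (dims p r) W (tprod m n U p q r A X)"
    unfolding cinner_transform[symmetric] tprod(2)[OF A X] ..
  finally show ?thesis
    using scale_pos by simp
qed


text \<open>In the transform domain the slices of \<open>a\<^sup>*\<close> and \<open>W\<close> are a column and a row, so the norm of their
  product is the product of their norms; summing over the slices gives the inequality. Of the three factors \<open>\<rho>\<close> from transforming the product,
  \<open>a\<close> and \<open>W\<close>, one survives.\<close>

lemma tnorm_tprod_tadjoint_row:
  assumes A: "A \<in> tensors (dims 1 q)" and W: "W \<in> tensors (dims 1 r)"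
  shows "(tnorm (dims q r) (tprod m n U q 1 r (tadjoint m n U 1 q A) W))\<^sup>2
       \<le> \<rho> * (tnorm (dims 1 q) A)\<^sup>2 * (tnorm (dims 1 r) W)\<^sup>2"
proof -
  let ?ts = "tail_dims m n"
  let ?a = "\<lambda>i is. (cmod (L A (0 # i # is)))\<^sup>2" and ?w = "\<lambda>j is. (cmod (L W (0 # j # is)))\<^sup>2"
  have "\<rho> * (tnorm (dims q r) (tprod m n U q 1 r (tadjoint m n U 1 q A) W))\<^sup>2
      = (tnorm (dims q r) (facewise_prod 1 (facewise_adjoint (L A)) (L W)))\<^sup>2"
    unfolding tnorm_transform[symmetric] tprod(2)[OF tadjoint(1)[OF A] W] tadjoint(2)[OF A] ..
  also have "\<dots> = (\<Sum>i<q. \<Sum>j<r. \<Sum>is\<in>index_box ?ts. ?a i is * ?w j is)"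
    by (simp add: tnorm_sq_sum sum_index_box_Cons facewise_prod_def facewise_adjoint_def
        norm_mult power_mult_distrib)
  also have "\<dots> \<le> (\<Sum>i<q. \<Sum>j<r. (\<Sum>is\<in>index_box ?ts. ?a i is) * (\<Sum>is\<in>index_box ?ts. ?w j is))"
  proof (intro sum_mono)
    fix i j
    have "(\<Sum>is\<in>index_box ?ts. ?a i is * ?w j is)
        \<le> (\<Sum>is\<in>index_box ?ts. ?a i is * (\<Sum>is\<in>index_box ?ts. ?w j is))"
      by (intro sum_mono mult_left_mono member_le_sum) (auto simp: finite_index_box)
    then show "(\<Sum>is\<in>index_box ?ts. ?a i is * ?w j is)
        \<le> (\<Sum>is\<in>index_box ?ts. ?a i is) * (\<Sum>is\<in>index_box ?ts. ?w j is)"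
      by (simp add: sum_distrib_right)
  qed
  also have "\<dots> = (\<Sum>i<q. \<Sum>is\<in>index_box ?ts. ?a i is) * (\<Sum>j<r. \<Sum>is\<in>index_box ?ts. ?w j is)"
    by (simp add: sum_product)
  also have "\<dots> = (tnorm (dims 1 q) (L A))\<^sup>2 * (tnorm (dims 1 r) (L W))\<^sup>2"
    by (simp add: tnorm_sq_sum sum_index_box_Cons)
  also have "\<dots> = \<rho> * (\<rho> * (tnorm (dims 1 q) A)\<^sup>2 * (tnorm (dims 1 r) W)\<^sup>2)"
    unfolding tnorm_transform by simp
  finally show ?thesis
    using scale_pos by simp
qed

text \<open>The bound for \<open>a\<close> is obtained from that for its adjoint by duality.\<close>

lemma tnorm_tprod_row:
  assumes A: "A \<in> tensors (dims 1 q)" and V: "V \<in> tensors (dims q r)"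
  shows "tnorm (dims 1 r) (tprod m n U 1 q r A V) \<le> sqrt \<rho> * tnorm (dims 1 q) A * tnorm (dims q r) V"
proof -
  let ?W = "tprod m n U 1 q r A V"
  let ?G = "tprod m n U q 1 r (tadjoint m n U 1 q A) ?W"
  have W: "?W \<in> tensors (dims 1 r)"
    by (rule tprod(1)[OF A V])
  have "(tnorm (dims q r) ?G)\<^sup>2 \<le> (sqrt \<rho> * tnorm (dims 1 q) A * tnorm (dims 1 r) ?W)\<^sup>2"
    using tnorm_tprod_tadjoint_row[OF A W] scale_pos by (simp add: power_mult_distrib)
  then have G: "tnorm (dims q r) ?G \<le> sqrt \<rho> * tnorm (dims 1 q) A * tnorm (dims 1 r) ?W"
    by (rule power2_le_imp_le) (use scale_pos in \<open>simp add: tnorm_nonneg\<close>)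
  have "tnorm (dims 1 r) ?W * tnorm (dims 1 r) ?W = tinner (dims q r) ?G V"
    using cinner_tprod_tadjoint[OF A W V] tnorm_sq[of "dims 1 r" ?W]
    by (simp add: tinner_cinner power2_eq_square)
  also have "\<dots> \<le> tnorm (dims q r) ?G * tnorm (dims q r) V"
    by (rule tinner_le_tnorm)
  also have "\<dots> \<le> (sqrt \<rho> * tnorm (dims 1 q) A * tnorm (dims 1 r) ?W) * tnorm (dims q r) V"
    by (intro mult_right_mono G tnorm_nonneg)
  finally have "tnorm (dims 1 r) ?W * tnorm (dims 1 r) ?W
      \<le> (sqrt \<rho> * tnorm (dims 1 q) A * tnorm (dims q r) V) * tnorm (dims 1 r) ?W"
    by (simp only: mult_ac)
  note bound = this
  show ?thesis
  proof (cases "tnorm (dims 1 r) ?W = 0")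
    case True
    then show ?thesis
      unfolding True using scale_pos by (simp add: tnorm_nonneg)
  next
    case False
    then have "0 < tnorm (dims 1 r) ?W"
      using tnorm_nonneg[of "dims 1 r" ?W] by linarith
    with bound show ?thesis
      by (rule mult_right_le_imp_le)
  qed
qed

end

section \<open>Strong convexity of the LSP objective\<close>

text \<open>The second derivative of \<open>lam ln (1 + u/\<epsilon>)\<close> is smallest at \<open>u = 0\<close>, with value
  \<open>- lam/\<epsilon>\<^sup>2\<close>, so this multiple of \<open>u\<^sup>2/2\<close> restores convexity on the half-line.\<close>

lemma log_plus_square_convex:
  fixes lam \<epsilon> :: real
  assumes "lam > 0" "\<epsilon> > 0"
  shows "convex_on {0..} (\<lambda>u. lam * ln (1 + u / \<epsilon>) + lam / \<epsilon>\<^sup>2 * u\<^sup>2 / 2)"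
proof -
  define \<kappa> where "\<kappa> = lam / \<epsilon>\<^sup>2"
  have "convex_on {0..} (\<lambda>u. lam * ln (1 + u / \<epsilon>) + \<kappa> * u\<^sup>2 / 2)"
  proof (rule f''_ge0_imp_convex)
    fix x :: real assume "x \<in> {0..}"
    then have x: "0 \<le> x" by simp
    then have pos: "\<epsilon> + x > 0" "1 + x / \<epsilon> > 0"
      using assms by (auto intro: add_pos_nonneg)
    have eq: "(1 + x / \<epsilon>) * \<epsilon> = \<epsilon> + x"
      using assms by (simp add: field_simps)
    show "((\<lambda>u. lam * ln (1 + u / \<epsilon>) + \<kappa> * u\<^sup>2 / 2)
        has_real_derivative lam / (\<epsilon> + x) + \<kappa> * x) (at x)"
      using pos assms by (auto intro!: derivative_eq_intros simp: eq)
    show "((\<lambda>u. lam / (\<epsilon> + u) + \<kappa> * u)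
        has_real_derivative - lam / (\<epsilon> + x)\<^sup>2 + \<kappa>) (at x)"
      using pos by (auto intro!: derivative_eq_intros simp: power2_eq_square)
    have "\<epsilon>\<^sup>2 \<le> (\<epsilon> + x)\<^sup>2"
      using x assms by (intro power_mono) auto
    then have "lam / (\<epsilon> + x)\<^sup>2 \<le> \<kappa>"
      using assms pos unfolding \<kappa>_def by (intro divide_left_mono) auto
    then show "0 \<le> - lam / (\<epsilon> + x)\<^sup>2 + \<kappa>"
      by simp
  qed simp
  then show ?thesis
    by (simp only: \<kappa>_def)
qed

lemma cmod_convex_combination_sq:
  "(cmod (x + of_real s * (y - x)))\<^sup>2
     = (1 - s) * (cmod x)\<^sup>2 + s * (cmod y)\<^sup>2 - s * (1 - s) * (cmod (y - x))\<^sup>2"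
  unfolding cmod_power2 by (simp add: power2_eq_square algebra_simps)

text \<open>The convex function of the preceding lemma is increasing on the half-line, hence it remains convex
  when composed with the modulus, in spite of the kink at \<open>0\<close>. What is left of the quadratic term
  has coefficient \<open>(1 - lam/\<epsilon>\<^sup>2)/2\<close> and gives the modulus of strong convexity.\<close>

lemma lsp_entry_strongly_convex:
  fixes lam \<epsilon> s :: real and x y :: complex
  assumes lam: "lam > 0" and \<epsilon>: "\<epsilon> > 0" and s: "0 \<le> s" "s \<le> 1"
  defines "g \<equiv> \<lambda>z. lam * ln (1 + cmod z / \<epsilon>) + (cmod z)\<^sup>2 / 2"
  shows "g (x + of_real s * (y - x))
       \<le> (1 - s) * g x + s * g y - (1 - lam / \<epsilon>\<^sup>2) / 2 * (s * (1 - s)) * (cmod (y - x))\<^sup>2"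
proof -
  define \<phi> where "\<phi> u = lam * ln (1 + u / \<epsilon>) + lam / \<epsilon>\<^sup>2 * u\<^sup>2 / 2" for u
  define \<kappa> where "\<kappa> = (1 - lam / \<epsilon>\<^sup>2) / 2"
  have g: "g z = \<phi> (cmod z) + \<kappa> * (cmod z)\<^sup>2" for z
    by (simp add: g_def \<phi>_def \<kappa>_def left_diff_distrib diff_divide_distrib)
  have mono: "\<phi> u \<le> \<phi> v" if "0 \<le> u" "u \<le> v" for u v
    unfolding \<phi>_def using that lam \<epsilon>
    by (intro add_mono mult_left_mono divide_right_mono power_mono ln_mono)
       (auto intro: add_pos_nonneg divide_right_mono)
  have "cmod (x + of_real s * (y - x)) = cmod (of_real (1 - s) * x + of_real s * y)"
    by (simp add: algebra_simps)
  also have "\<dots> \<le> cmod (of_real (1 - s) * x) + cmod (of_real s * y)"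
    by (rule norm_triangle_ineq)
  also have "\<dots> = (1 - s) * cmod x + s * cmod y"
    unfolding norm_mult norm_of_real using s by simp
  finally have "\<phi> (cmod (x + of_real s * (y - x))) \<le> \<phi> ((1 - s) * cmod x + s * cmod y)"
    by (intro mono) auto
  also have "\<dots> \<le> (1 - s) * \<phi> (cmod x) + s * \<phi> (cmod y)"
    using convex_onD[OF log_plus_square_convex[OF lam \<epsilon>] s, of "cmod x" "cmod y"]
    by (simp add: \<phi>_def)
  finally show ?thesis
    unfolding g \<kappa>_def[symmetric] cmod_convex_combination_sq by (simp add: algebra_simps)
qed

lemma lsp_objective_sum:
  "lsp_objective ds lam \<epsilon> X
     = (\<Sum>ix\<in>index_box ds. lam * ln (1 + cmod (X ix) / \<epsilon>) + (cmod (X ix))\<^sup>2 / 2)"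
  by (simp add: lsp_objective_def tnorm_sq_sum sum.distrib sum_divide_distrib)

lemma lsp_objective_strongly_convex:
  assumes "lam > 0" "\<epsilon> > 0" "0 \<le> s" "s \<le> 1"
  shows "lsp_objective ds lam \<epsilon> (X + tscale s (Y - X))
       \<le> (1 - s) * lsp_objective ds lam \<epsilon> X + s * lsp_objective ds lam \<epsilon> Y
         - (1 - lam / \<epsilon>\<^sup>2) / 2 * (s * (1 - s)) * (tnorm ds (Y - X))\<^sup>2"
  unfolding lsp_objective_sum tnorm_sq_sum sum_distrib_left sum.distrib[symmetric] sum_subtractf[symmetric]
proof (rule sum_mono, goal_cases)
  case (1 ix)
  show ?case
    using lsp_entry_strongly_convex[OF assms, of "X ix" "Y ix"] by (simp add: tscale_def)
qed

text \<open>Completing the square, the proximal point of \<open>Z\<close> minimises \<open>f - \<langle>Z, \<cdot>\<rangle>\<close>. Comparing it with the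
  points of the segment from \<open>X\<close> to \<open>Y\<close> near \<open>X\<close> shows that \<open>Z\<close> is a subgradient of \<open>f\<close> at \<open>X\<close>, and
  strong convexity adds the quadratic term.\<close>

lemma prox_LSP_strong_subgradient:
  assumes lam: "lam > 0" and \<epsilon>: "\<epsilon> > 0"
    and X: "X \<in> prox_LSP ds lam \<epsilon> Z" and Y: "Y \<in> real_tensors ds"
  shows "lsp_objective ds lam \<epsilon> X + tinner ds Z (Y - X) + (1 - lam / \<epsilon>\<^sup>2) / 2 * (tnorm ds (Y - X))\<^sup>2
       \<le> lsp_objective ds lam \<epsilon> Y"
proof -
  let ?f = "lsp_objective ds lam \<epsilon>" and ?c = "(1 - lam / \<epsilon>\<^sup>2) / 2 * (tnorm ds (Y - X))\<^sup>2"
  have Xreal: "X \<in> real_tensors ds"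
    and min: "lam * LSP ds \<epsilon> X + 1/2 * (tnorm ds (X - Z))\<^sup>2
            \<le> lam * LSP ds \<epsilon> V + 1/2 * (tnorm ds (V - Z))\<^sup>2" if "V \<in> real_tensors ds" for V
    using X that by (auto simp: prox_LSP_def is_arg_min_def not_less)
  have expand: "lam * LSP ds \<epsilon> V + 1/2 * (tnorm ds (V - Z))\<^sup>2 = ?f V - tinner ds Z V + 1/2 * (tnorm ds Z)\<^sup>2" for V
    by (simp add: LSP_def lsp_objective_def tnorm_sq tinner_linear tinner_commute[of ds V Z]
        sum_distrib_left algebra_simps)
  have "tinner ds Z (Y - X) \<le> ?f Y - ?f X - ?c * (1 - s)" if s: "0 < s" "s < 1" for s
  proof -
    let ?V = "X + tscale s (Y - X)"
    have "?V \<in> real_tensors ds"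
      using Xreal[OF Y] Y by (intro real_tensors_add real_tensors_scale real_tensors_diff)
    then have "?f X - tinner ds Z X \<le> ?f ?V - tinner ds Z ?V"
      using min[of ?V] unfolding expand by simp
    then have "?f X + s * tinner ds Z (Y - X) \<le> ?f ?V"
      by (simp add: tinner_linear)
    also have "\<dots> \<le> (1 - s) * ?f X + s * ?f Y - (1 - lam / \<epsilon>\<^sup>2) / 2 * (s * (1 - s)) * (tnorm ds (Y - X))\<^sup>2"
      using s by (intro lsp_objective_strongly_convex lam \<epsilon>) auto
    finally have "s * tinner ds Z (Y - X) \<le> s * (?f Y - ?f X - ?c * (1 - s))"
      by (simp add: algebra_simps)
    then show ?thesis
      using s by simp
  qed
  then have "\<forall>\<^sub>F s in at_right 0. tinner ds Z (Y - X) \<le> ?f Y - ?f X - ?c * (1 - s)"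
    by (auto simp: eventually_at_right_field intro!: exI[of _ 1])
  moreover have "((\<lambda>s. ?f Y - ?f X - ?c * (1 - s)) \<longlongrightarrow> ?f Y - ?f X - ?c * (1 - 0)) (at_right 0)"
    by (intro tendsto_intros)
  ultimately have "tinner ds Z (Y - X) \<le> ?f Y - ?f X - ?c * (1 - 0)"
    by (intro tendsto_lowerbound) auto
  then show ?thesis
    by simp
qed

lemma prox_LSP_real: "X \<in> prox_LSP ds lam \<epsilon> Z \<Longrightarrow> X \<in> real_tensors ds"
  by (simp add: prox_LSP_def is_arg_min_def)

lemma lsp_objective_tendsto:
  assumes \<epsilon>: "\<epsilon> > 0" and lim: "\<And>ix. ix \<in> index_box ds \<Longrightarrow> (\<lambda>k. W k ix) \<longlonglongrightarrow> V ix"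
  shows "(\<lambda>k. lsp_objective ds lam \<epsilon> (W k)) \<longlonglongrightarrow> lsp_objective ds lam \<epsilon> V"
  unfolding lsp_objective_sum
proof (intro tendsto_intros lim)
  show "1 + cmod (V ix) / \<epsilon> \<noteq> 0" "\<epsilon> \<noteq> 0" for ix
    using \<epsilon> divide_nonneg_pos[of "cmod (V ix)" \<epsilon>] norm_ge_zero[of "V ix"] by linarith+
qed auto

section \<open>Convergence of cyclic Bregman projections\<close>

lemma tnorm_tendsto:
  assumes "\<And>ix. ix \<in> index_box ds \<Longrightarrow> (\<lambda>k. W k ix) \<longlonglongrightarrow> V ix"
  shows "(\<lambda>k. tnorm ds (W k)) \<longlonglongrightarrow> tnorm ds V"
  unfolding tnorm_def by (intro tendsto_intros assms)

lemma tnorm_tendsto_0_entry: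
  assumes "(\<lambda>k. tnorm ds (W k - V)) \<longlonglongrightarrow> 0" "ix \<in> index_box ds"
  shows "(\<lambda>k. W k ix) \<longlonglongrightarrow> V ix"
proof -
  have "cmod (W k ix - V ix) \<le> tnorm ds (W k - V)" for k
    using cmod_le_tnorm[OF assms(2), of "W k - V"] by simp
  then have "(\<lambda>k. W k ix - V ix) \<longlonglongrightarrow> 0"
    by (intro tendsto_0_le[OF assms(1), of _ 1]) (simp add: tnorm_nonneg)
  then show ?thesis
    by (simp add: LIM_zero_iff)
qed

lemma bounded_tensors_convergent_subsequence:
  fixes X :: "nat \<Rightarrow> tensor"
  assumes real: "\<And>k. X k \<in> real_tensors ds" and bound: "\<And>k. tnorm ds (X k - Y) \<le> b"
  obtains V r where "V \<in> real_tensors ds" "strict_mono r"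
    "\<And>ix. ix \<in> index_box ds \<Longrightarrow> (\<lambda>k. X (r k) ix) \<longlonglongrightarrow> V ix"
proof -
  have "bounded ((\<lambda>W. W ix) ` range X)" if "ix \<in> index_box ds" for ix
  proof -
    have "cmod (X k ix) \<le> b + cmod (Y ix)" for k
    proof -
      have "cmod (X k ix) \<le> cmod (X k ix - Y ix) + cmod (Y ix)"
        using norm_triangle_ineq[of "X k ix - Y ix" "Y ix"] by simp
      then show ?thesis
        using cmod_le_tnorm[OF that, of "X k - Y"] bound[of k] by simp
    qed
    then show ?thesis
      by (auto simp: bounded_iff)
  qed
  then have "\<forall>\<delta>\<subseteq>index_box ds. \<exists>l r. strict_mono r \<and>
      (\<forall>e>0. \<forall>\<^sub>F k in sequentially. \<forall>ix\<in>\<delta>. dist (X (r k) ix) (l ix) < e)"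
    by (intro compact_lemma_general[of "index_box ds" "\<lambda>W ix. W ix" X "\<lambda>W. W"]) (auto simp: finite_index_box)
  then obtain l :: tensor and r :: "nat \<Rightarrow> nat" where r: "strict_mono r"
    and l: "\<And>e. e > 0 \<Longrightarrow> \<forall>\<^sub>F k in sequentially. \<forall>ix\<in>index_box ds. dist (X (r k) ix) (l ix) < e"
    by blast
  define V where "V ix = (if ix \<in> index_box ds then l ix else 0)" for ix
  have lim: "(\<lambda>k. X (r k) ix) \<longlonglongrightarrow> V ix" if "ix \<in> index_box ds" for ix
    unfolding tendsto_iff
  proof (intro allI impI)
    fix e :: real assume "e > 0"
    from l[OF this] show "\<forall>\<^sub>F k in sequentially. dist (X (r k) ix) (V ix) < e"
      by (rule eventually_mono) (use that in \<open>simp add: V_def\<close>)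
  qed
  have "V ix \<in> \<real>" for ix
  proof (cases "ix \<in> index_box ds")
    case True
    have "(\<lambda>k. Im (X (r k) ix)) \<longlonglongrightarrow> Im (V ix)"
      by (intro tendsto_intros lim True)
    moreover have "(\<lambda>k. Im (X (r k) ix)) = (\<lambda>_. 0)"
      using real by (auto simp: real_tensors_def complex_is_Real_iff)
    ultimately show ?thesis
      by (simp add: LIMSEQ_const_iff complex_is_Real_iff)
  qed (simp add: V_def)
  then have "V \<in> real_tensors ds"
    by (simp add: real_tensors_def tensors_def V_def)
  with r lim that show thesis
    by blast
qed

text \<open>The Bregman distance changes by the linear term \<open>\<langle>Z' - Z, X - Y\<rangle>\<close> and an error
  \<open>\<langle>Z' - Z, X' - X\<rangle>\<close>. Young's inequality splits the error into a part absorbed by the strong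
  convexity of \<open>f\<close> and the part \<open>\<parallel>Z' - Z\<parallel>\<^sup>2/(2\<sigma>)\<close>, which is what limits the step size.\<close>

lemma bregman_mirror_step:
  assumes \<sigma>: "\<sigma> > 0"
    and subgradient: "f X + tinner ds Z (X' - X) + \<sigma> / 2 * (tnorm ds (X' - X))\<^sup>2 \<le> f X'"
    and inner: "tinner ds (Z' - Z) (X - Y) = - (t * w)"
    and norm: "(tnorm ds (Z' - Z))\<^sup>2 \<le> t\<^sup>2 * \<rho> * w"
  shows "bregman ds f Z' X' Y \<le> bregman ds f Z X Y - t * (1 - t * \<rho> / (2 * \<sigma>)) * w"
proof -
  let ?a = "tnorm ds (Z' - Z)" and ?b = "tnorm ds (X' - X)"
  have "0 \<le> (?a - \<sigma> * ?b)\<^sup>2 / (2 * \<sigma>)"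
    using \<sigma> by simp
  also have "\<dots> = ?a\<^sup>2 / (2 * \<sigma>) - ?a * ?b + \<sigma> / 2 * ?b\<^sup>2"
    using \<sigma> by (simp add: power2_eq_square field_simps)
  finally have young: "tinner ds (Z' - Z) (X' - X) \<le> ?a\<^sup>2 / (2 * \<sigma>) + \<sigma> / 2 * ?b\<^sup>2"
    using tinner_le_tnorm[of ds "Z' - Z" "X' - X"] by linarith
  have "bregman ds f Z' X' Y - bregman ds f Z X Y
      = f X - f X' + tinner ds Z (X' - X) + tinner ds (Z' - Z) (X' - X) + tinner ds (Z' - Z) (X - Y)"
    by (simp add: bregman_def tinner_linear)
  also have "\<dots> \<le> ?a\<^sup>2 / (2 * \<sigma>) - t * w"
    using subgradient young inner by linarith
  also have "\<dots> \<le> (t\<^sup>2 * \<rho> * w) / (2 * \<sigma>) - t * w"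
    using norm \<sigma> by (intro diff_right_mono divide_right_mono) auto
  also have "\<dots> = - (t * (1 - t * \<rho> / (2 * \<sigma>)) * w)"
    by (simp add: power2_eq_square algebra_simps)
  finally show ?thesis
    by simp
qed

text \<open>The convergence argument depends on the linear system only through the seminorms
  \<open>q i\<close> of the residuals of its blocks. For \<open>Y \<in> S\<close> the Bregman distances \<open>D\<^sub>k(Y)\<close> decrease, which
  bounds the primal iterates and makes the residuals visited, and with them the increments
  \<open>X\<^sub>k\<^sub>+\<^sub>1 - X\<^sub>k\<close>, tend to zero. As every block is visited within \<open>p\<close> steps, all residuals tend to
  zero, and every limit point \<open>V\<close> of \<open>X\<^sub>k\<close> is in \<open>S\<close>. Now \<open>D\<^sub>k(V)\<close> is monotone and tends to zero along
  a subsequence, therefore along the whole sequence, which gives \<open>X\<^sub>k \<rightarrow> V\<close>. Orthogonality of \<open>Z\<^sub>k\<close> to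
  differences of elements of \<open>S\<close> turns the subgradient inequality at \<open>X\<^sub>k\<close> into
  \<open>f(Y) \<ge> f(V) + \<sigma>/2 \<parallel>Y - V\<parallel>\<^sup>2\<close> in the limit, so \<open>V\<close> is the unique minimiser.\<close>

lemma cyclic_bregman_convergence:
  fixes f :: "tensor \<Rightarrow> real" and X Z :: "nat \<Rightarrow> tensor" and q :: "nat \<Rightarrow> tensor \<Rightarrow> real"
  assumes p: "0 < p" and S: "S \<subseteq> real_tensors ds" "S \<noteq> {}"
    and X: "\<And>k. X k \<in> real_tensors ds"
    and q_nonneg: "\<And>i V. 0 \<le> q i V"
    and q_triangle: "\<And>i V W. i < p \<Longrightarrow> V \<in> real_tensors ds \<Longrightarrow> W \<in> real_tensors ds
                       \<Longrightarrow> q i (V + W) \<le> q i V + q i W"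
    and q_bound: "\<And>i V. i < p \<Longrightarrow> V \<in> real_tensors ds \<Longrightarrow> q i V \<le> C * tnorm ds V"
    and S_closed: "\<And>V Y. V \<in> real_tensors ds \<Longrightarrow> Y \<in> S \<Longrightarrow> (\<And>i. i < p \<Longrightarrow> q i (V - Y) = 0) \<Longrightarrow> V \<in> S"
    and \<sigma>: "\<sigma> > 0"
    and subgradient: "\<And>k Y. Y \<in> real_tensors ds \<Longrightarrow>
          f (X k) + tinner ds (Z k) (Y - X k) + \<sigma> / 2 * (tnorm ds (Y - X k))\<^sup>2 \<le> f Y"
    and c: "c > 0"
    and descent: "\<And>k Y. Y \<in> S \<Longrightarrow> bregman ds f (Z (Suc k)) (X (Suc k)) Y
                    \<le> bregman ds f (Z k) (X k) Y - c * (q (k mod p) (X k - Y))\<^sup>2"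
    and step: "\<And>k Y. Y \<in> S \<Longrightarrow> tnorm ds (Z (Suc k) - Z k) \<le> C' * q (k mod p) (X k - Y)"
    and orth: "\<And>k Y Y'. Y \<in> S \<Longrightarrow> Y' \<in> S \<Longrightarrow> tinner ds (Z k) (Y - Y') = 0"
    and cont: "\<And>W V. (\<And>ix. ix \<in> index_box ds \<Longrightarrow> (\<lambda>k. W k ix) \<longlonglongrightarrow> V ix) \<Longrightarrow> (\<lambda>k. f (W k)) \<longlonglongrightarrow> f V"
  shows "\<exists>Xopt. {Y. is_arg_min f (\<lambda>Y. Y \<in> S) Y} = {Xopt} \<and> (\<lambda>k. tnorm ds (X k - Xopt)) \<longlonglongrightarrow> 0"
proof -
  define D where "D k Y = bregman ds f (Z k) (X k) Y" for k Y
  obtain Y0 where Y0: "Y0 \<in> S" "Y0 \<in> real_tensors ds"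
    using S by auto
  have D_lower: "\<sigma> / 2 * (tnorm ds (Y - X k))\<^sup>2 \<le> D k Y" if "Y \<in> S" for k Y
    using subgradient[of Y k] that S(1) by (auto simp: D_def bregman_def)
  have D_nonneg: "0 \<le> D k Y" if "Y \<in> S" for k Y
  proof -
    have "0 \<le> \<sigma> / 2 * (tnorm ds (Y - X k))\<^sup>2"
      using \<sigma> by simp
    then show ?thesis
      using D_lower[OF that, of k] by linarith
  qed
  have D_step: "c * (q (k mod p) (X k - Y))\<^sup>2 \<le> D k Y - D (Suc k) Y" if "Y \<in> S" for k Y
    using descent[OF that, of k] by (simp add: D_def)
  have D_dec: "decseq (\<lambda>k. D k Y)" if "Y \<in> S" for Y
  proof (rule decseq_SucI)
    fix k
    have "0 \<le> c * (q (k mod p) (X k - Y))\<^sup>2"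
      using c by simp
    then show "D (Suc k) Y \<le> D k Y"
      using D_step[OF that, of k] by linarith
  qed
  have D_conv: "\<exists>d. (\<lambda>k. D k Y) \<longlonglongrightarrow> d" if "Y \<in> S" for Y
    using decseq_convergent[OF D_dec[OF that], of 0] D_nonneg[OF that] by metis

  define r where "r k = q (k mod p) (X k - Y0)" for k
  have r0: "r \<longlonglongrightarrow> 0"
  proof -
    obtain d where d: "(\<lambda>k. D k Y0) \<longlonglongrightarrow> d"
      using D_conv Y0 by blast
    have lim: "(\<lambda>k. (D k Y0 - D (Suc k) Y0) / c) \<longlonglongrightarrow> (d - d) / c"
      using c by (intro tendsto_intros d LIMSEQ_Suc[OF d]) auto
    have "(\<lambda>k. (r k)\<^sup>2) \<longlonglongrightarrow> 0"
    proof (rule tendsto_sandwich[of "\<lambda>_. 0"])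
      show "\<forall>\<^sub>F k in sequentially. (r k)\<^sup>2 \<le> (D k Y0 - D (Suc k) Y0) / c"
        using D_step[OF Y0(1)] c by (intro always_eventually) (simp add: r_def field_simps)
    qed (use lim in auto)
    then have "(\<lambda>k. sqrt ((r k)\<^sup>2)) \<longlonglongrightarrow> sqrt 0"
      by (rule tendsto_real_sqrt)
    then show ?thesis
      using q_nonneg by (simp add: r_def[abs_def])
  qed

  define dX where "dX k = tnorm ds (X (Suc k) - X k)" for k
  \<comment> \<open>Adding the strong subgradient inequalities at \<open>X\<^sub>k\<close> and \<open>X\<^sub>k\<^sub>+\<^sub>1\<close> shows that the primal iterates
    depend on the dual ones in a Lipschitz way.\<close>
  have dX_le: "dX k \<le> C' / \<sigma> * r k" for k
  proof -
    have "\<sigma> * dX k * dX k \<le> tinner ds (Z (Suc k) - Z k) (X (Suc k) - X k)"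
      using subgradient[OF X[of "Suc k"], of k] subgradient[OF X[of k], of "Suc k"]
        tnorm_minus_commute[of ds "X (Suc k)" "X k"]
      by (simp add: dX_def tinner_linear power2_eq_square algebra_simps)
    also have "\<dots> \<le> tnorm ds (Z (Suc k) - Z k) * dX k"
      unfolding dX_def by (rule tinner_le_tnorm)
    also have "\<dots> \<le> (C' * r k) * dX k"
      using step[OF Y0(1), of k] by (intro mult_right_mono) (simp_all add: r_def dX_def tnorm_nonneg)
    finally have *: "\<sigma> * dX k * dX k \<le> (C' * r k) * dX k" .
    show ?thesis
    proof (cases "dX k = 0")
      case True
      have "0 \<le> C' * r k"
        using step[OF Y0(1), of k] tnorm_nonneg[of ds "Z (Suc k) - Z k"] by (simp add: r_def)
      then show ?thesis
        using True \<sigma> by simp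
    next
      case False
      then have "0 < dX k"
        using tnorm_nonneg[of ds "X (Suc k) - X k"] by (simp add: dX_def)
      then have "\<sigma> * dX k \<le> C' * r k"
        using * by simp
      then show ?thesis
        using \<sigma> by (simp add: field_simps)
    qed
  qed
  have dX0: "dX \<longlonglongrightarrow> 0"
  proof (rule tendsto_sandwich[of "\<lambda>_. 0" dX _ "\<lambda>k. C' / \<sigma> * r k"])
    show "(\<lambda>k. C' / \<sigma> * r k) \<longlonglongrightarrow> 0"
      using tendsto_mult_left[OF r0, of "C' / \<sigma>"] by simp
    show "\<forall>\<^sub>F k in sequentially. dX k \<le> C' / \<sigma> * r k"
      by (intro always_eventually allI dX_le)
  qed (simp_all add: dX_def tnorm_nonneg)

  have dX_sum: "tnorm ds (X (k + s) - X k) \<le> (\<Sum>j<s. dX (k + j))" for k s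
  proof (induction s)
    case 0
    then show ?case by (simp add: tnorm_def)
  next
    case (Suc s)
    have "X (k + Suc s) - X k = (X (Suc (k + s)) - X (k + s)) + (X (k + s) - X k)"
      by simp
    then have "tnorm ds (X (k + Suc s) - X k) \<le> dX (k + s) + tnorm ds (X (k + s) - X k)"
      unfolding dX_def by (metis tnorm_triangle)
    then show ?case
      using Suc unfolding sum.lessThan_Suc by linarith
  qed
  have residual_le: "q i (X k - Y0) \<le> (\<Sum>j<p. r (k + j)) + \<bar>C\<bar> * (\<Sum>j<p. dX (k + j))" if i: "i < p" for i k
  proof -
    \<comment> \<open>The waiting time until block \<open>i\<close> is visited next.\<close>
    define s where "s = (i + (p - k mod p)) mod p"
    have s: "s < p" "(k + s) mod p = i"
    proof -
      show "s < p"
        using p by (simp add: s_def)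
      have "(k + s) mod p = (k mod p + (i + (p - k mod p))) mod p"
        unfolding s_def by (simp add: mod_add_right_eq mod_add_left_eq)
      also have "k mod p + (i + (p - k mod p)) = i + p"
        using p mod_less_divisor[of p k] by linarith
      finally show "(k + s) mod p = i"
        using i by simp
    qed
    have "X k - Y0 = (X k - X (k + s)) + (X (k + s) - Y0)"
      by simp
    then have "q i (X k - Y0) \<le> q i (X k - X (k + s)) + q i (X (k + s) - Y0)"
      using q_triangle[OF i real_tensors_diff[OF X X] real_tensors_diff[OF X Y0(2)]] by metis
    also have "q i (X (k + s) - Y0) = r (k + s)"
      by (simp add: r_def s(2))
    also have "r (k + s) \<le> (\<Sum>j<p. r (k + j))"
      using s(1) q_nonneg by (intro member_le_sum[of s "{..<p}" "\<lambda>j. r (k + j)"]) (auto simp: r_def)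
    also have "q i (X k - X (k + s)) \<le> C * tnorm ds (X (k + s) - X k)"
      using q_bound[OF i real_tensors_diff[OF X[of k] X[of "k + s"]]] by (simp add: tnorm_minus_commute)
    also have "\<dots> \<le> \<bar>C\<bar> * (\<Sum>j<p. dX (k + j))"
    proof (rule mult_mono)
      have "(\<Sum>j<s. dX (k + j)) \<le> (\<Sum>j<p. dX (k + j))"
        using s(1) by (intro sum_mono2) (auto simp: dX_def tnorm_nonneg)
      then show "tnorm ds (X (k + s) - X k) \<le> (\<Sum>j<p. dX (k + j))"
        using dX_sum[of k s] by linarith
    qed (auto simp: tnorm_nonneg)
    finally show ?thesis
      by linarith
  qed
  have residual0: "(\<lambda>k. q i (X k - Y0)) \<longlonglongrightarrow> 0" if i: "i < p" for i
  proof (rule tendsto_sandwich[of "\<lambda>_. 0"])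
    have "(\<lambda>k. (\<Sum>j<p. r (k + j)) + \<bar>C\<bar> * (\<Sum>j<p. dX (k + j))) \<longlonglongrightarrow> (\<Sum>j<p. 0) + \<bar>C\<bar> * (\<Sum>j<p. 0)"
      by (intro tendsto_intros LIMSEQ_ignore_initial_segment r0 dX0)
    then show "(\<lambda>k. (\<Sum>j<p. r (k + j)) + \<bar>C\<bar> * (\<Sum>j<p. dX (k + j))) \<longlonglongrightarrow> 0"
      by simp
  qed (auto simp: q_nonneg residual_le[OF i])

  have bounded: "tnorm ds (X k - Y0) \<le> sqrt (2 / \<sigma> * D 0 Y0)" for k
  proof (rule real_le_rsqrt)
    have "D k Y0 \<le> D 0 Y0"
      using D_dec[OF Y0(1)] by (simp add: decseq_def)
    then show "(tnorm ds (X k - Y0))\<^sup>2 \<le> 2 / \<sigma> * D 0 Y0"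
      using D_lower[OF Y0(1), of k] \<sigma> tnorm_minus_commute[of ds "X k" Y0] by (simp add: field_simps)
  qed
  obtain V \<tau> where V: "V \<in> real_tensors ds" and \<tau>: "strict_mono \<tau>"
    and sub: "\<And>ix. ix \<in> index_box ds \<Longrightarrow> (\<lambda>k. X (\<tau> k) ix) \<longlonglongrightarrow> V ix"
    by (rule bounded_tensors_convergent_subsequence[where X = X and ds = ds, OF X bounded]) (rule that)
  have subnorm: "(\<lambda>k. tnorm ds (V - X (\<tau> k))) \<longlonglongrightarrow> 0"
  proof -
    have "(\<lambda>k. tnorm ds (V - X (\<tau> k))) \<longlonglongrightarrow> tnorm ds (V - V)"
    proof (rule tnorm_tendsto)
      fix ix assume "ix \<in> index_box ds"
      then have "(\<lambda>k. V ix - X (\<tau> k) ix) \<longlonglongrightarrow> V ix - V ix"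
        by (intro tendsto_intros sub)
      then show "(\<lambda>k. (V - X (\<tau> k)) ix) \<longlonglongrightarrow> (V - V) ix"
        by simp
    qed
    then show ?thesis
      by (simp add: tnorm_def)
  qed
  have VS: "V \<in> S"
  proof (rule S_closed[OF V Y0(1)])
    fix i assume i: "i < p"
    have "q i (V - Y0) \<le> C * tnorm ds (V - X (\<tau> k)) + q i (X (\<tau> k) - Y0)" for k
    proof -
      have "V - Y0 = (V - X (\<tau> k)) + (X (\<tau> k) - Y0)"
        by simp
      then have "q i (V - Y0) \<le> q i (V - X (\<tau> k)) + q i (X (\<tau> k) - Y0)"
        using q_triangle[OF i real_tensors_diff[OF V X] real_tensors_diff[OF X Y0(2)]] by metis
      then show ?thesis
        using q_bound[OF i real_tensors_diff[OF V X[of "\<tau> k"]]] by linarith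
    qed
    moreover have "(\<lambda>k. C * tnorm ds (V - X (\<tau> k)) + q i (X (\<tau> k) - Y0)) \<longlonglongrightarrow> C * 0 + 0"
      using LIMSEQ_subseq_LIMSEQ[OF residual0[OF i] \<tau>] by (intro tendsto_intros subnorm) (simp add: o_def)
    ultimately have "q i (V - Y0) \<le> C * 0 + 0"
      by (intro LIMSEQ_le_const) auto
    then show "q i (V - Y0) = 0"
      using q_nonneg[of i "V - Y0"] by simp
  qed
  have D0: "(\<lambda>k. D k V) \<longlonglongrightarrow> 0"
  proof -
    \<comment> \<open>The subgradient inequality at the reflected point \<open>2X\<^sub>k - V\<close> bounds \<open>-\<langle>Z\<^sub>k, V - X\<^sub>k\<rangle>\<close> from above
      in terms of \<open>f\<close> alone, which is continuous.\<close>
    have "D k V \<le> f V - 2 * f (X k) + f (X k + (X k - V))" for k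
    proof -
      have "0 \<le> \<sigma> / 2 * (tnorm ds (X k + (X k - V) - X k))\<^sup>2"
        using \<sigma> by simp
      then have "f (X k) + tinner ds (Z k) (X k + (X k - V) - X k) \<le> f (X k + (X k - V))"
        using subgradient[OF real_tensors_add[OF X real_tensors_diff[OF X V]], of k k k] by linarith
      then show ?thesis
        by (simp add: D_def bregman_def tinner_linear)
    qed
    moreover have "(\<lambda>k. f V - 2 * f (X (\<tau> k)) + f (X (\<tau> k) + (X (\<tau> k) - V))) \<longlonglongrightarrow> f V - 2 * f V + f V"
    proof (intro tendsto_intros cont sub)
      fix ix assume "ix \<in> index_box ds"
      then have "(\<lambda>k. X (\<tau> k) ix + (X (\<tau> k) ix - V ix)) \<longlonglongrightarrow> V ix + (V ix - V ix)"
        by (intro tendsto_intros sub)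
      then show "(\<lambda>k. (X (\<tau> k) + (X (\<tau> k) - V)) ix) \<longlonglongrightarrow> V ix"
        by simp
    qed
    ultimately have "(\<lambda>k. D (\<tau> k) V) \<longlonglongrightarrow> 0"
      using D_nonneg[OF VS] by (intro tendsto_sandwich[of "\<lambda>_. 0" "\<lambda>k. D (\<tau> k) V"]) auto
    moreover obtain d where d: "(\<lambda>k. D k V) \<longlonglongrightarrow> d"
      using D_conv[OF VS] by blast
    moreover have "(\<lambda>k. D (\<tau> k) V) \<longlonglongrightarrow> d"
      using LIMSEQ_subseq_LIMSEQ[OF d \<tau>] by (simp only: o_def)
    ultimately show ?thesis
      using LIMSEQ_unique by metis
  qed
  have X_lim: "(\<lambda>k. tnorm ds (X k - V)) \<longlonglongrightarrow> 0"
  proof -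
    have "(\<lambda>k. (tnorm ds (X k - V))\<^sup>2) \<longlonglongrightarrow> 0"
    proof (rule tendsto_sandwich[of "\<lambda>_. 0" _ _ "\<lambda>k. 2 / \<sigma> * D k V"])
      show "\<forall>\<^sub>F k in sequentially. (tnorm ds (X k - V))\<^sup>2 \<le> 2 / \<sigma> * D k V"
        using D_lower[OF VS] \<sigma>
        by (intro always_eventually) (simp add: field_simps tnorm_minus_commute[of ds _ V])
      show "(\<lambda>k. 2 / \<sigma> * D k V) \<longlonglongrightarrow> 0"
        using tendsto_mult_left[OF D0, of "2 / \<sigma>"] by simp
    qed auto
    then have "(\<lambda>k. sqrt ((tnorm ds (X k - V))\<^sup>2)) \<longlonglongrightarrow> sqrt 0"
      by (rule tendsto_real_sqrt)
    then show ?thesis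
      by (simp add: tnorm_nonneg)
  qed
  have growth: "f V + \<sigma> / 2 * (tnorm ds (Y - V))\<^sup>2 \<le> f Y" if Y: "Y \<in> S" for Y
  proof -
    \<comment> \<open>Here \<open>\<langle>Z\<^sub>k, Y - X\<^sub>k\<rangle>\<close> may be replaced by \<open>\<langle>Z\<^sub>k, V - X\<^sub>k\<rangle>\<close>, which turns it into \<open>D\<^sub>k(V)\<close>.\<close>
    have "f V - D k V + \<sigma> / 2 * (tnorm ds (Y - X k))\<^sup>2 \<le> f Y" for k
      using subgradient[of Y k] Y S(1) orth[OF Y VS, of k] by (auto simp: D_def bregman_def tinner_linear)
    moreover have "(\<lambda>k. f V - D k V + \<sigma> / 2 * (tnorm ds (Y - X k))\<^sup>2)
        \<longlonglongrightarrow> f V - 0 + \<sigma> / 2 * (tnorm ds (Y - V))\<^sup>2"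
    proof (intro tendsto_intros D0 tnorm_tendsto)
      fix ix assume "ix \<in> index_box ds"
      then have "(\<lambda>k. Y ix - X k ix) \<longlonglongrightarrow> Y ix - V ix"
        by (intro tendsto_intros tnorm_tendsto_0_entry[OF X_lim])
      then show "(\<lambda>k. (Y - X k) ix) \<longlonglongrightarrow> (Y - V) ix"
        by simp
    qed
    ultimately have "f V - 0 + \<sigma> / 2 * (tnorm ds (Y - V))\<^sup>2 \<le> f Y"
      by (intro LIMSEQ_le_const2) auto
    then show ?thesis
      by simp
  qed
  have "{Y. is_arg_min f (\<lambda>Y. Y \<in> S) Y} = {V}"
  proof (rule subset_antisym)
    have "f V \<le> f Y" if "Y \<in> S" for Y
    proof -
      have "0 \<le> \<sigma> / 2 * (tnorm ds (Y - V))\<^sup>2"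
        using \<sigma> by simp
      then show ?thesis
        using growth[OF that] by linarith
    qed
    then show "{V} \<subseteq> {Y. is_arg_min f (\<lambda>Y. Y \<in> S) Y}"
      using VS by (auto simp: is_arg_min_def not_less)
    show "{Y. is_arg_min f (\<lambda>Y. Y \<in> S) Y} \<subseteq> {V}"
    proof
      fix Y assume "Y \<in> {Y. is_arg_min f (\<lambda>Y. Y \<in> S) Y}"
      then have Y: "Y \<in> S" "f Y \<le> f V"
        using VS by (auto simp: is_arg_min_def not_less)
      then have "\<sigma> / 2 * (tnorm ds (Y - V))\<^sup>2 \<le> 0"
        using growth[OF Y(1)] by linarith
      then have "tnorm ds (Y - V) = 0"
        using \<sigma> by (simp add: mult_le_0_iff)
      moreover have "Y - V \<in> tensors ds"
        using Y(1) V S(1) by (auto intro: tensors_diff real_tensors_tensors)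
      ultimately have "Y - V = 0"
        by (simp only: tnorm_eq_0_iff)
      then show "Y \<in> {V}"
        by simp
    qed
  qed
  with X_lim show ?thesis
    by blast
qed

section \<open>The regularized Kaczmarz iteration\<close>

text \<open>One step adds \<open>t G\<close> to the dual iterate, where \<open>G = -N\<^sup>-\<^sup>1 a\<^sup>* *\<^sub>L (a *\<^sub>L (X - Y))\<close> for every solution
  \<open>Y\<close> of the slice equation. Moving \<open>a\<^sup>*\<close> to the other side of the inner product turns the pairing of
  \<open>G\<close> with the error into the squared residual, which is also what bounds the length of \<open>G\<close>.\<close>

lemma (in scaled_unitary_transform) kaczmarz_update:
  fixes X Y a :: tensor
  assumes a: "a \<in> tensors (dims 1 q)" "a \<noteq> 0"
    and X: "X \<in> tensors (dims q r)" and Y: "Y \<in> tensors (dims q r)"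
  defines "N \<equiv> (tnorm (dims 1 q) a)\<^sup>2"
  defines "G \<equiv> tprod m n U q 1 r (tadjoint m n U 1 q a)
                  (tscale (1 / N) (tprod m n U 1 q r a Y - tprod m n U 1 q r a X))"
  shows "tinner (dims q r) G (X - Y) = - ((tnorm (dims 1 r) (tprod m n U 1 q r a (X - Y)))\<^sup>2 / N)"
    and "(tnorm (dims q r) G)\<^sup>2 \<le> \<rho> * ((tnorm (dims 1 r) (tprod m n U 1 q r a (X - Y)))\<^sup>2 / N)"
proof -
  let ?R = "tprod m n U 1 q r a (X - Y)"
  have N: "N > 0"
    using a tnorm_eq_0_iff[OF a(1)] by (simp add: N_def)
  have R: "?R \<in> tensors (dims 1 r)"
    by (rule tprod(1)[OF a(1) tensors_diff[OF X Y]])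
  have W: "tscale (1 / N) (tprod m n U 1 q r a Y - tprod m n U 1 q r a X) = tscale (- 1 / N) ?R"
    unfolding tprod_diff_right[OF a(1) X Y] by (simp add: tscale_def fun_eq_iff algebra_simps)
  have G: "G = tprod m n U q 1 r (tadjoint m n U 1 q a) (tscale (- 1 / N) ?R)"
    unfolding G_def W ..
  have "tinner (dims q r) G (X - Y) = tinner (dims 1 r) (tscale (- 1 / N) ?R) ?R"
    unfolding G tinner_cinner cinner_tprod_tadjoint[OF a(1) tensors_scale[OF R] tensors_diff[OF X Y]] ..
  then show "tinner (dims q r) G (X - Y) = - ((tnorm (dims 1 r) ?R)\<^sup>2 / N)"
    unfolding tinner_scale_left tnorm_sq by simp
  have "(tnorm (dims q r) G)\<^sup>2 \<le> \<rho> * N * (tnorm (dims 1 r) (tscale (- 1 / N) ?R))\<^sup>2"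
    unfolding G N_def by (rule tnorm_tprod_tadjoint_row[OF a(1) tensors_scale[OF R]])
  also have "\<dots> = \<rho> * ((tnorm (dims 1 r) ?R)\<^sup>2 / N)"
    unfolding tnorm_scale using N by (simp add: power_mult_distrib power2_eq_square)
  finally show "(tnorm (dims q r) G)\<^sup>2 \<le> \<rho> * ((tnorm (dims 1 r) ?R)\<^sup>2 / N)" .
qed

text \<open>The dual iterates stay orthogonal to the kernel of \<open>A\<close>: the initial one is of the form \<open>A\<^sup>* *\<^sub>L Y\<close>, each
  increment is of the form \<open>a\<^sup>* *\<^sub>L W\<close> for a slice \<open>a\<close> of \<open>A\<close>, and a tensor annihilated by \<open>A\<close> is
  annihilated by each slice. In the limit this is the optimality condition for the constrained
  problem.\<close>

lemma (in scaled_unitary_transform) kaczmarz_dual_orthogonal: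
  assumes A: "A \<in> tensors (dims (n 1) (n 2))" and B: "B \<in> tensors (dims (n 1) l)"
    and X: "\<And>k. X k \<in> tensors (dims (n 2) l)"
    and run: "lsp_kaczmarz m n U l A B lam \<epsilon> t i Z X"
    and V: "V \<in> tensors (dims (n 2) l)" "tprod m n U (n 1) (n 2) l A V = 0"
  shows "tinner (dims (n 2) l) (Z k) V = 0"
proof (induction k)
  case 0
  obtain Y where Y: "Y \<in> tensors (dims (n 1) l)"
    and Z0: "Z 0 = tprod m n U (n 2) (n 1) l (tadjoint m n U (n 1) (n 2) A) Y"
    using run by (auto simp: lsp_kaczmarz_def row_space_def intro: real_tensors_tensors)
  show ?case
    unfolding Z0 tinner_cinner cinner_tprod_tadjoint[OF A Y V(1)] V(2) by (simp add: cinner_def)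
next
  case (Suc k)
  let ?a = "hslice A (i k)"
  define W where "W = tscale (1 / (tnorm (dims 1 (n 2)) ?a)\<^sup>2)
      (hslice B (i k) - tprod m n U 1 (n 2) l ?a (X k))"
  have Z: "Z (Suc k) = Z k + tscale t (tprod m n U (n 2) 1 l (tadjoint m n U 1 (n 2) ?a) W)"
    using run unfolding lsp_kaczmarz_def W_def by blast
  have a: "?a \<in> tensors (dims 1 (n 2))"
    by (rule hslice_tensors[OF A])
  have W: "W \<in> tensors (dims 1 l)"
    unfolding W_def by (intro tensors_scale tensors_diff hslice_tensors[OF B] tprod(1)[OF a X])
  have "tprod m n U 1 (n 2) l ?a V = 0"
    unfolding hslice_tprod[OF A V(1)] V(2) by (simp add: hslice_def fun_eq_iff split: list.split)
  then have "tinner (dims (n 2) l) (tprod m n U (n 2) 1 l (tadjoint m n U 1 (n 2) ?a) W) V = 0"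
    unfolding tinner_cinner cinner_tprod_tadjoint[OF a W V(1)] by (simp add: cinner_def)
  then show ?case
    unfolding Z tinner_add_left tinner_scale_left using Suc by simp
qed

theorem theorem3p10:
  fixes m l :: nat and n :: "nat \<Rightarrow> nat" and U :: "nat \<Rightarrow> complex mat"
    and \<rho> lam \<epsilon> t :: real
    and A B :: tensor and Z X :: "nat \<Rightarrow> tensor"
  defines "xdims \<equiv> n 2 # l # tail_dims m n"
  defines "f \<equiv> lsp_objective xdims lam \<epsilon>"
  assumes "m \<ge> 3"
    and "\<forall>i\<in>{1..m}. n i \<ge> 1" and "l \<ge> 1"
    and "\<forall>i\<in>{3..m}. U i \<in> carrier_mat (n i) (n i) \<and> invertible_mat (U i)"
    and "\<rho> > 0"
    and "transform_kron m U * mat_adjoint (transform_kron m U)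
           = complex_of_real \<rho> \<cdot>\<^sub>m 1\<^sub>m (\<Prod>i=3..m. n i)"
    and "mat_adjoint (transform_kron m U) * transform_kron m U
           = complex_of_real \<rho> \<cdot>\<^sub>m 1\<^sub>m (\<Prod>i=3..m. n i)"
    and "\<forall>p q r. \<forall>C\<in>real_tensors (p # q # tail_dims m n). \<forall>D\<in>real_tensors (q # r # tail_dims m n).
           tprod m n U p q r C D \<in> real_tensors (p # r # tail_dims m n)"
    and "A \<in> real_tensors (n 1 # n 2 # tail_dims m n)"
    and "\<forall>i<n 1. hslice A i \<noteq> 0"
    and "B \<in> real_tensors (n 1 # l # tail_dims m n)"
    and "solutions m n U l A B \<noteq> {}"
    and "\<forall>Xopt. is_arg_min f (\<lambda>Y. Y \<in> solutions m n U l A B) Xopt \<longrightarrow>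
           subdifferential xdims f Xopt \<inter> row_space m n U l A \<noteq> {}"
    and "lam > 0" and "\<epsilon> > 0" and "t > 0"
    and "lsp_kaczmarz m n U l A B lam \<epsilon> t (\<lambda>k. k mod n 1) Z X"
    and "\<forall>k. \<forall>ix\<in>index_box xdims. (cmod (Z k ix) + \<epsilon>)\<^sup>2 \<ge> 4 * lam"
    and "t < (2 - 2 * lam / \<epsilon>\<^sup>2) / \<rho>"
  shows "(\<forall>k. \<forall>Y\<in>solutions m n U l A B.
            bregman xdims f (Z (Suc k)) (X (Suc k)) Y
              \<le> bregman xdims f (Z k) (X k) Y
                 - t * (1 - t * \<rho> / (2 - 2 * lam / \<epsilon>\<^sup>2))
                   * ((tnorm (1 # l # tail_dims m n)
                         (tprod m n U 1 (n 2) l (hslice A (k mod n 1)) (X k - Y)))\<^sup>2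
                      / (tnorm (1 # n 2 # tail_dims m n) (hslice A (k mod n 1)))\<^sup>2))
         \<and> (\<exists>Xopt. {Y. is_arg_min f (\<lambda>Y. Y \<in> solutions m n U l A B) Y} = {Xopt}
              \<and> (\<lambda>k. tnorm xdims (X k - Xopt)) \<longlonglongrightarrow> 0)"
proof -
  interpret scaled_unitary_transform m n U \<rho>
  proof
    show "0 < n i" if "i \<in> {3..m}" for i
      using assms(4) that by (auto simp: Suc_le_eq)
    show "U i \<in> carrier_mat (n i) (n i) \<and> invertible_mat (U i)" if "i \<in> {3..m}" for i
      using assms(6) that by blast
  qed (use assms(3,7,9) in simp_all)
  note lam = \<open>lam > 0\<close> and \<epsilon> = \<open>\<epsilon> > 0\<close> and t = \<open>t > 0\<close>
    and run = \<open>lsp_kaczmarz m n U l A B lam \<epsilon> t (\<lambda>k. k mod n 1) Z X\<close>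
  define \<sigma> where "\<sigma> = 1 - lam / \<epsilon>\<^sup>2"
  have two_\<sigma>: "2 - 2 * lam / \<epsilon>\<^sup>2 = 2 * \<sigma>"
    by (simp add: \<sigma>_def)
  have t_less: "t * \<rho> < 2 * \<sigma>"
    using \<open>t < (2 - 2 * lam / \<epsilon>\<^sup>2) / \<rho>\<close> \<open>\<rho> > 0\<close> by (simp add: two_\<sigma> pos_less_divide_eq)
  then have \<sigma>: "\<sigma> > 0"
    using mult_pos_pos[OF t \<open>\<rho> > 0\<close>] by linarith
  have rows: "0 < n 1"
    using assms(3,4) by force
  have A: "A \<in> tensors (dims (n 1) (n 2))" and B: "B \<in> tensors (dims (n 1) l)"
    using assms(11,13) by (auto intro: real_tensors_tensors)
  have prox: "X k \<in> prox_LSP xdims lam \<epsilon> (Z k)" for k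
    using run by (simp add: lsp_kaczmarz_def xdims_def)
  have Xreal: "X k \<in> real_tensors xdims" for k
    by (rule prox_LSP_real[OF prox])
  then have X: "X k \<in> tensors (dims (n 2) l)" for k
    unfolding xdims_def by (rule real_tensors_tensors)
  have subgradient: "f (X k) + tinner xdims (Z k) (Y - X k) + \<sigma> / 2 * (tnorm xdims (Y - X k))\<^sup>2 \<le> f Y"
    if "Y \<in> real_tensors xdims" for k Y
    using prox_LSP_strong_subgradient[OF lam \<epsilon> prox that] by (simp only: f_def \<sigma>_def)
  define S where "S = solutions m n U l A B"
  have S: "Y \<in> real_tensors xdims" "Y \<in> tensors (dims (n 2) l)" "tprod m n U (n 1) (n 2) l A Y = B"
    if "Y \<in> S" for Y
    using that real_tensors_tensors by (auto simp: S_def solutions_def xdims_def)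
  define a where "a i = hslice A i" for i
  have a: "a i \<in> tensors (dims 1 (n 2))" for i
    unfolding a_def by (rule hslice_tensors[OF A])
  define h where "h i = tnorm (dims 1 (n 2)) (a i)" for i
  have h: "0 < h i" if "i < n 1" for i
    using assms(12) that tnorm_eq_0_iff[OF a, of i] tnorm_nonneg[of "dims 1 (n 2)" "a i"]
    by (auto simp: h_def a_def less_le)
  define q where "q i V = tnorm (dims 1 l) (tprod m n U 1 (n 2) l (a i) V)" for i V

  have dual_step: "tinner xdims (Z (Suc k) - Z k) (X k - Y) = - (t * ((q (k mod n 1) (X k - Y))\<^sup>2 / (h (k mod n 1))\<^sup>2))"
      "(tnorm xdims (Z (Suc k) - Z k))\<^sup>2 \<le> t\<^sup>2 * \<rho> * ((q (k mod n 1) (X k - Y))\<^sup>2 / (h (k mod n 1))\<^sup>2)"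
    if Y: "Y \<in> S" for k Y
  proof -
    let ?i = "k mod n 1"
    have i: "?i < n 1"
      using rows by simp
    have nz: "a ?i \<noteq> 0"
      using assms(12) i by (simp add: a_def)
    have "hslice B ?i = tprod m n U 1 (n 2) l (a ?i) Y"
      unfolding a_def hslice_tprod[OF A S(2)[OF Y]] S(3)[OF Y] ..
    moreover define G where "G = tprod m n U (n 2) 1 l (tadjoint m n U 1 (n 2) (a ?i))
        (tscale (1 / (h ?i)\<^sup>2) (tprod m n U 1 (n 2) l (a ?i) Y - tprod m n U 1 (n 2) l (a ?i) (X k)))"
    ultimately have "Z (Suc k) = Z k + tscale t G"
      using run unfolding lsp_kaczmarz_def h_def a_def by simp
    then have step: "Z (Suc k) - Z k = tscale t G"
      by simp
    note update = kaczmarz_update[OF a nz X[of k] S(2)[OF Y], folded h_def q_def xdims_def, folded G_def]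
    show "tinner xdims (Z (Suc k) - Z k) (X k - Y) = - (t * ((q ?i (X k - Y))\<^sup>2 / (h ?i)\<^sup>2))"
      unfolding step tinner_scale_left update(1) by simp
    have "(tnorm xdims (Z (Suc k) - Z k))\<^sup>2 = t\<^sup>2 * (tnorm xdims G)\<^sup>2"
      unfolding step tnorm_scale by (simp add: power_mult_distrib)
    also have "\<dots> \<le> t\<^sup>2 * (\<rho> * ((q ?i (X k - Y))\<^sup>2 / (h ?i)\<^sup>2))"
      by (intro mult_left_mono update(2)) simp
    finally show "(tnorm xdims (Z (Suc k) - Z k))\<^sup>2 \<le> t\<^sup>2 * \<rho> * ((q ?i (X k - Y))\<^sup>2 / (h ?i)\<^sup>2)"
      by (simp only: mult.assoc)
  qed
  have descent: "bregman xdims f (Z (Suc k)) (X (Suc k)) Y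
      \<le> bregman xdims f (Z k) (X k) Y
         - t * (1 - t * \<rho> / (2 * \<sigma>)) * ((q (k mod n 1) (X k - Y))\<^sup>2 / (h (k mod n 1))\<^sup>2)"
    if "Y \<in> S" for k Y
    by (rule bregman_mirror_step[OF \<sigma>]) (rule subgradient[OF Xreal] dual_step[OF that])+

  define \<gamma> where "\<gamma> = t * (1 - t * \<rho> / (2 * \<sigma>))"
  have \<gamma>: "\<gamma> > 0"
    using t t_less \<sigma> by (simp add: \<gamma>_def)
  have "\<exists>Xopt. {Y. is_arg_min f (\<lambda>Y. Y \<in> S) Y} = {Xopt} \<and> (\<lambda>k. tnorm xdims (X k - Xopt)) \<longlonglongrightarrow> 0"
  proof (rule cyclic_bregman_convergence[where q = q and p = "n 1" and \<sigma> = \<sigma> and Z = Z])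
    show "0 < n 1" "\<sigma> > 0" "S \<subseteq> real_tensors xdims" "S \<noteq> {}"
      using rows \<sigma> S(1) assms(14) by (auto simp: S_def)
    show "X k \<in> real_tensors xdims" for k
      by (rule Xreal)
    show "0 \<le> q i V" for i V
      by (simp add: q_def tnorm_nonneg)
    show "q i (V + W) \<le> q i V + q i W"
      if "V \<in> real_tensors xdims" "W \<in> real_tensors xdims" for i V W
    proof -
      have VW: "V \<in> tensors (dims (n 2) l)" "W \<in> tensors (dims (n 2) l)"
        using that real_tensors_tensors unfolding xdims_def by auto
      have "tprod m n U 1 (n 2) l (a i) ((V + W) - W)
          = tprod m n U 1 (n 2) l (a i) (V + W) - tprod m n U 1 (n 2) l (a i) W"
        by (rule tprod_diff_right[OF a tensors_add[OF VW] VW(2)])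
      then have "tprod m n U 1 (n 2) l (a i) (V + W)
          = tprod m n U 1 (n 2) l (a i) V + tprod m n U 1 (n 2) l (a i) W"
        by (metis add_diff_cancel_right' diff_add_cancel)
      then show ?thesis
        unfolding q_def by (simp only: tnorm_triangle)
    qed
    show "q i V \<le> sqrt \<rho> * (\<Sum>j<n 1. h j) * tnorm xdims V"
      if "i < n 1" "V \<in> real_tensors xdims" for i V
    proof -
      have "V \<in> tensors (dims (n 2) l)"
        using that(2) real_tensors_tensors unfolding xdims_def by auto
      then have "q i V \<le> sqrt \<rho> * h i * tnorm xdims V"
        unfolding q_def h_def xdims_def by (rule tnorm_tprod_row[OF a])
      also have "h i \<le> (\<Sum>j<n 1. h j)"
        using that h by (intro member_le_sum) (auto simp: less_imp_le)
      finally show ?thesis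
        using \<open>\<rho> > 0\<close> by (simp add: mult_right_mono mult_left_mono tnorm_nonneg)
    qed
    show "V \<in> S" if V: "V \<in> real_tensors xdims" and Y: "Y \<in> S"
      and zero: "\<And>i. i < n 1 \<Longrightarrow> q i (V - Y) = 0" for V Y
    proof -
      have V': "V \<in> tensors (dims (n 2) l)"
        using V real_tensors_tensors unfolding xdims_def by auto
      have "tprod m n U (n 1) (n 2) l A V = tprod m n U (n 1) (n 2) l A Y"
      proof (rule hslice_eq_imp_eq[OF tprod(1)[OF A V'] tprod(1)[OF A S(2)[OF Y]]])
        fix i assume "i < n 1"
        then have "tprod m n U 1 (n 2) l (a i) (V - Y) = 0"
          using zero tnorm_eq_0_iff[OF tprod(1)[OF a tensors_diff[OF V' S(2)[OF Y]]]] by (simp add: q_def)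
        then have "tprod m n U 1 (n 2) l (a i) V = tprod m n U 1 (n 2) l (a i) Y"
          unfolding tprod_diff_right[OF a V' S(2)[OF Y]] by (metis eq_iff_diff_eq_0)
        then show "hslice (tprod m n U (n 1) (n 2) l A V) i = hslice (tprod m n U (n 1) (n 2) l A Y) i"
          unfolding a_def hslice_tprod[OF A V'] hslice_tprod[OF A S(2)[OF Y]] .
      qed
      then show ?thesis
        using V S(3)[OF Y] by (simp add: S_def solutions_def xdims_def)
    qed
    show "f (X k) + tinner xdims (Z k) (Y - X k) + \<sigma> / 2 * (tnorm xdims (Y - X k))\<^sup>2 \<le> f Y"
      if "Y \<in> real_tensors xdims" for k Y
      by (rule subgradient[OF that])
    have hsum: "0 < (\<Sum>j<n 1. (h j)\<^sup>2)"
      using rows h by (intro sum_pos) (auto simp: less_imp_neq[symmetric])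
    \<comment> \<open>The decrease per step is weighted by \<open>1/\<parallel>a\<^sub>i\<parallel>\<^sup>2\<close>; replacing \<open>\<parallel>a\<^sub>i\<parallel>\<^sup>2\<close> by the sum over all slices
      gives a constant that serves for every slice.\<close>
    show "0 < \<gamma> / (\<Sum>j<n 1. (h j)\<^sup>2)"
      using \<gamma> hsum by simp
    show "bregman xdims f (Z (Suc k)) (X (Suc k)) Y
        \<le> bregman xdims f (Z k) (X k) Y - \<gamma> / (\<Sum>j<n 1. (h j)\<^sup>2) * (q (k mod n 1) (X k - Y))\<^sup>2"
      if "Y \<in> S" for k Y
    proof -
      let ?i = "k mod n 1"
      have i: "?i < n 1"
        using rows by simp
      have "(h ?i)\<^sup>2 \<le> (\<Sum>j<n 1. (h j)\<^sup>2)"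
        using i by (intro member_le_sum) auto
      then have "(q ?i (X k - Y))\<^sup>2 / (\<Sum>j<n 1. (h j)\<^sup>2) \<le> (q ?i (X k - Y))\<^sup>2 / (h ?i)\<^sup>2"
        using h[OF i] hsum by (intro divide_left_mono) auto
      then have "\<gamma> * ((q ?i (X k - Y))\<^sup>2 / (\<Sum>j<n 1. (h j)\<^sup>2)) \<le> \<gamma> * ((q ?i (X k - Y))\<^sup>2 / (h ?i)\<^sup>2)"
        using \<gamma> by (intro mult_left_mono) auto
      then show ?thesis
        using descent[OF that, of k] unfolding \<gamma>_def[symmetric] by simp
    qed
    show "tnorm xdims (Z (Suc k) - Z k) \<le> t * sqrt \<rho> * (\<Sum>j<n 1. 1 / h j) * q (k mod n 1) (X k - Y)"
      if "Y \<in> S" for k Y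
    proof -
      let ?i = "k mod n 1"
      have i: "?i < n 1"
        using rows by simp
      have q: "0 \<le> q ?i (X k - Y)"
        by (simp add: q_def tnorm_nonneg)
      have "(tnorm xdims (Z (Suc k) - Z k))\<^sup>2 \<le> (t * sqrt \<rho> * (1 / h ?i) * q ?i (X k - Y))\<^sup>2"
        using dual_step(2)[OF that, of k] \<open>\<rho> > 0\<close>
        unfolding power_mult_distrib power_divide real_sqrt_pow2[OF less_imp_le[OF \<open>\<rho> > 0\<close>]] by simp
      then have "tnorm xdims (Z (Suc k) - Z k) \<le> t * sqrt \<rho> * (1 / h ?i) * q ?i (X k - Y)"
        by (rule power2_le_imp_le) (use t \<open>\<rho> > 0\<close> h[OF i] q in simp)
      also have "\<dots> \<le> t * sqrt \<rho> * (\<Sum>j<n 1. 1 / h j) * q ?i (X k - Y)"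
      proof (intro mult_right_mono mult_left_mono q)
        show "1 / h ?i \<le> (\<Sum>j<n 1. 1 / h j)"
          using i h by (intro member_le_sum[of ?i "{..<n 1}" "\<lambda>j. 1 / h j"]) (auto simp: less_imp_le)
      qed (use t \<open>\<rho> > 0\<close> in auto)
      finally show ?thesis .
    qed
    show "tinner xdims (Z k) (Y - Y') = 0" if "Y \<in> S" "Y' \<in> S" for k Y Y'
      unfolding xdims_def
    proof (rule kaczmarz_dual_orthogonal[OF A B X run])
      show "Y - Y' \<in> tensors (dims (n 2) l)"
        by (intro tensors_diff S that)
      show "tprod m n U (n 1) (n 2) l A (Y - Y') = 0"
        unfolding tprod_diff_right[OF A S(2)[OF that(1)] S(2)[OF that(2)]] S(3)[OF that(1)] S(3)[OF that(2)]
        by simp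
    qed
    show "(\<lambda>k. f (W k)) \<longlonglongrightarrow> f V"
      if "\<And>ix. ix \<in> index_box xdims \<Longrightarrow> (\<lambda>k. W k ix) \<longlonglongrightarrow> V ix" for W V
      unfolding f_def by (rule lsp_objective_tendsto[OF \<epsilon> that])
  qed
  then show ?thesis
    using descent unfolding two_\<sigma> S_def q_def h_def a_def by blast
qed

end
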